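(* Let $F$ be a cumulative distribution function all of whose moments exist, with mean $\mu_1=0$ and variance $\mu_2=\bar\sigma^2>0$, and whose characteristic function $\phi(\xi)$ tends to $0$ as $\xi\to\pm\infty$. Let $X_1,X_2,\dots$ be i.i.d. with distribution $F$, let $S_n=(X_1+\dots+X_n)/(\bar\sigma\sqrt n)$ and $F_n(x)=\mathbb P(S_n\le x)$. Let $\mu_k=\mathbb E[X_1^k]$ and $$c_n=\frac{\mu_3}{6\mu_2^{3/2}\sqrt n},\qquad d_n=\frac{\mu_4-3\mu_2^2}{24\mu_2^2 n},\qquad p_n(x)=x+c_n(1-x^2)+d_n(3x-x^3)+c_n^2(4x^3-7x).$$ Let $(\kappa_n)$ be a sequence with $1\le\kappa_n$ and $\kappa_n=o(n^{1/16})$. Then for all sufficiently large $n$, $p_n$ is strictly increasing (hence invertible) on $[-\kappa_n,\kappa_n]$, and $$\sup_{|x|\le\kappa_n}\big|\Phi(p_n(x))-F_n(x)\big|=o(1/n)\quad(n\to\infty).$$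
   Context: $\Phi$ denotes the standard normal cumulative distribution function. *)

theory Defs
  imports "HOL-Probability.Probability" "HOL-Library.Landau_Symbols"
begin

definition Phi :: "real \<Rightarrow> real" where
  "Phi x = cdf std_normal_distribution x"

definition c_coef :: "real \<Rightarrow> real \<Rightarrow> nat \<Rightarrow> real" where
  "c_coef mu2 mu3 n = mu3 / (6 * mu2 powr (3/2) * sqrt (real n))"

definition d_coef :: "real \<Rightarrow> real \<Rightarrow> nat \<Rightarrow> real" where
  "d_coef mu2 mu4 n = (mu4 - 3 * mu2\<^sup>2) / (24 * mu2\<^sup>2 * real n)"

definition p_poly :: "real \<Rightarrow> real \<Rightarrow> real \<Rightarrow> nat \<Rightarrow> real \<Rightarrow> real" where
  "p_poly mu2 mu3 mu4 n x =
     x + c_coef mu2 mu3 n * (1 - x\<^sup>2) + d_coef mu2 mu4 n * (3 * x - x ^ 3)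
       + (c_coef mu2 mu3 n)\<^sup>2 * (4 * x ^ 3 - 7 * x)"

end

theory Submission
  imports Defs "HOL-Real_Asymp.Real_Asymp"
begin

text \<open>The Edgeworth approximation \<open>G\<close> of order \<open>1/n\<close> has Fourier transform
  \<open>g(t) = exp(-t\<^sup>2/2) (1 + c (it)\<^sup>3 + d t\<^sup>4 + c\<^sup>2/2 (it)\<^sup>6)\<close>, obtained by expanding the
  logarithm of the characteristic function at \<open>0\<close>. Adding to the normalized sum a uniform variable on \<open>[-h, h]\<close>
  with \<open>h = \<eta>/n\<close> changes the distribution functions by \<open>O(\<eta>/n)\<close> and multiplies the characteristic
  function by a factor of size \<open>1/(h|t|)\<close>. For \<open>|t| > \<delta> \<surd>n\<close> the characteristic function itself is at most \<open>q\<^sup>n\<close>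
  with \<open>q < 1\<close>, since it has modulus less than \<open>1\<close> away from \<open>0\<close> and vanishes at infinity; hence
  this range contributes only \<open>O(n q\<^sup>n)\<close> to Levy's inversion integral, and no truncation of the integral is needed.
  Finally \<open>\<Phi>(p\<^sub>n(x))\<close> and \<open>G(x)\<close> agree up to \<open>O(n\<^sup>-\<^sup>3\<^sup>/\<^sup>2 \<kappa>\<^sub>n\<^sup>6)\<close> by Taylor's formula.\<close>

section \<open>Characteristic functions away from the origin\<close>

text \<open>The uniform variable settles this with two features. Its support is bounded, so adding
  it moves the argument of a distribution function by at most h, with no tail term. Its transform
  decays like 1/|t|, so after the division by t in the inversion formula the integrand is O(1/t^2).
  The resulting factor 1/h = n/\<eta> is harmless against q^n. The smoothing error stays of order
  \<eta>/n, so o(1/n) is reached by choosing \<eta> in terms of \<epsilon>. All estimates in t are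
  brought to the one shape E |t| / (1 + t^2): the factor |t| cancels the pole of the kernel, and the
  integral of 1/(1 + t^2) is at most pi, which the prefactor 1/(2 pi) absorbs. The polynomial p_n(x)
  = x + \<delta> is made so that \<delta> - x \<delta>^2 / 2 cancels the Hermite correction of G up
  to order 1/n. The remainder is o(1/n) once n^(-1/2) \<kappa>^6 tends to 0, and 6/16 < 1/2.\<close>

lemma (in real_distribution) cmod_char_double_eq_1:
  assumes "cmod (char M u) = 1"
  shows "cmod (char M (2 * u)) = 1"
proof -
  define z where "z = char M u"
  define \<theta> where "\<theta> = Arg z"
  have z: "z = cis \<theta>"
    using rcis_cmod_Arg[of z] assms by (simp add: z_def \<theta>_def rcis_def)
  have rot: "integrable M (\<lambda>x. cos (v * x - \<alpha>))"
            "(\<integral>x. cos (v * x - \<alpha>) \<partial>M) = Re (cis (-\<alpha>) * char M v)" for v \<alpha>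
  proof -
    have int: "integrable M (\<lambda>x. iexp (v * x))"
      by (intro integrable_iexp) auto
    have eq: "cos (v * x - \<alpha>) = Re (cis (-\<alpha>) * iexp (v * x))" for x
      by (simp add: cis_conv_exp flip: exp_add) (simp add: Re_exp algebra_simps)
    show "integrable M (\<lambda>x. cos (v * x - \<alpha>))"
      unfolding eq using int by (intro integrable_Re integrable_mult_right)
    show "(\<integral>x. cos (v * x - \<alpha>) \<partial>M) = Re (cis (-\<alpha>) * char M v)"
      unfolding eq char_def using int
      by (subst integral_Re) (auto simp del: times_complex.simps)
  qed
  have "(\<integral>x. cos (u * x - \<theta>) \<partial>M) = 1"
    by (simp only: rot(2) z_def[symmetric]) (simp add: z cis_mult)
  \<comment> \<open>The inequality cos 2y >= 4 cos y - 3, that is 2 (cos y - 1)^2 >= 0, is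
    integrated. It replaces the argument that \<open>u * x - \<theta>\<close> lies almost surely in
    the multiples of 2 pi.\<close>
  then have "1 = (\<integral>x. 4 * cos (u * x - \<theta>) - 3 \<partial>M)"
    using rot(1)[of u \<theta>] prob_space by (subst Bochner_Integration.integral_diff) auto
  also have "\<dots> \<le> (\<integral>x. cos (2 * u * x - 2 * \<theta>) \<partial>M)"
  proof (rule integral_mono)
    fix x
    have "cos (2 * u * x - 2 * \<theta>) = 2 * (cos (u * x - \<theta>))\<^sup>2 - 1"
      using cos_double_cos[of "u * x - \<theta>"] by (simp add: algebra_simps)
    moreover have "0 \<le> 2 * (cos (u * x - \<theta>) - 1)\<^sup>2" by simp
    ultimately show "4 * cos (u * x - \<theta>) - 3 \<le> cos (2 * u * x - 2 * \<theta>)"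
      by (simp add: power2_eq_square algebra_simps)
  qed (use rot(1) in auto)
  also have "\<dots> \<le> cmod (cis (-(2 * \<theta>)) * char M (2 * u))"
    unfolding rot(2) by (rule complex_Re_le_cmod)
  also have "\<dots> = cmod (char M (2 * u))" by (simp add: norm_mult)
  finally show ?thesis using cmod_char_le_1[of "2 * u"] by simp
qed

text \<open>Modulus 1 at \<open>u\<close> would propagate by doubling to all points
  \<open>2 ^ k * u\<close>, which run off to infinity, where the characteristic function
  vanishes.\<close>

lemma (in real_distribution) cmod_char_less_1:
  assumes "(char M \<longlongrightarrow> 0) at_infinity" "u \<noteq> 0"
  shows "cmod (char M u) < 1"
proof (rule ccontr)
  assume "\<not> cmod (char M u) < 1"
  with cmod_char_le_1[of u] have "cmod (char M u) = 1" by simp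
  then have *: "cmod (char M (2 ^ k * u)) = 1" for k
    by (induction k) (auto simp: mult.assoc dest: cmod_char_double_eq_1)
  have "filterlim (\<lambda>k::nat. (2::real) ^ k * u) at_infinity sequentially"
    using assms(2) by (intro tendsto_mult_filterlim_at_infinity[OF tendsto_const] filterlim_realpow_sequentially_gt1
       | subst mult.commute | simp)+
  then have "(\<lambda>k. char M (2 ^ k * u)) \<longlonglongrightarrow> 0"
    by (rule filterlim_compose[OF assms(1)])
  then have "(\<lambda>k. cmod (char M (2 ^ k * u))) \<longlonglongrightarrow> 0" by (rule tendsto_norm_zero)
  then show False by (simp add: * LIMSEQ_const_iff)
qed

text \<open>Beyond some R the limit gives 1/2; on the compact rest a maximum is attained and is
  below 1. A uniform \<open>q\<close> is what makes the n-th power geometrically small.\<close>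

lemma (in real_distribution) cmod_char_bounded_away:
  assumes lim: "(char M \<longlongrightarrow> 0) at_infinity" and "\<delta> > 0"
  obtains q where "0 \<le> q" "q < 1" "\<And>u. \<delta> \<le> \<bar>u\<bar> \<Longrightarrow> cmod (char M u) \<le> q"
proof -
  have "\<forall>\<^sub>F u in at_infinity. cmod (char M u) < 1/2"
    using tendsto_norm_zero[OF lim] by (rule order_tendstoD) simp
  then obtain R where R: "\<And>u. R \<le> \<bar>u\<bar> \<Longrightarrow> cmod (char M u) < 1/2"
    by (auto simp: eventually_at_infinity)
  \<comment> \<open>\<open>max R \<delta>\<close> keeps \<open>K\<close> nonempty even if
    \<open>R < \<delta>\<close>, so that the maximum exists.\<close>
  define K where "K = {u. \<delta> \<le> \<bar>u\<bar> \<and> \<bar>u\<bar> \<le> max R \<delta>}"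
  have K: "compact K" "K \<noteq> {}"
  proof -
    have "K = cball 0 (max R \<delta>) \<inter> {u. \<delta> \<le> \<bar>u\<bar>}" by (auto simp: K_def)
    also have "compact \<dots>"
      by (intro compact_Int_closed compact_cball closed_Collect_le continuous_intros)
    finally show "compact K" .
    show "K \<noteq> {}" using \<open>\<delta> > 0\<close> by (auto simp: K_def intro!: exI[of _ \<delta>])
  qed
  have "continuous_on K (\<lambda>u. cmod (char M u))"
    by (intro continuous_on_norm continuous_at_imp_continuous_on ballI isCont_char)
  from continuous_attains_sup[OF K this] obtain v
    where v: "v \<in> K" "\<And>u. u \<in> K \<Longrightarrow> cmod (char M u) \<le> cmod (char M v)" by auto
  show ?thesis
  proof (rule that[of "max (1/2) (cmod (char M v))"])
    have "v \<noteq> 0" using v(1) \<open>\<delta> > 0\<close> by (auto simp: K_def)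
    then show "max (1/2) (cmod (char M v)) < 1" using cmod_char_less_1[OF lim] by simp
    fix u :: real assume "\<delta> \<le> \<bar>u\<bar>"
    then show "cmod (char M u) \<le> max (1/2) (cmod (char M v))"
      using R[of u] v(2)[of u] by (cases "R \<le> \<bar>u\<bar>") (auto simp: K_def)
  qed simp
qed

text \<open>Taylor's formula on the disc of radius 1/2, where \<open>1 + z\<close> has real part at
  least 1/2 and so avoids the branch cut. The third derivative 2/(1+z)^3 is at most 16 there, and
  the library bound divides by 2!, which gives 8.\<close>

lemma Ln_approx_quadratic:
  assumes "cmod z \<le> 1/2"
  shows "cmod (Ln (1 + z) - (z - z\<^sup>2 / 2)) \<le> 8 * cmod z ^ 3"
proof -
  define f :: "nat \<Rightarrow> complex \<Rightarrow> complex" where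
    "f i z = (if i = 0 then Ln (1 + z) else if i = 1 then inverse (1 + z)
       else if i = 2 then - (inverse (1 + z) ^ 2) else 2 * inverse (1 + z) ^ 3)" for i z
  have bnd: "1/2 \<le> Re (1 + x)" "1/2 \<le> cmod (1 + x)" if "x \<in> cball 0 (1/2)" for x :: complex
  proof -
    show "1/2 \<le> Re (1 + x)"
      using abs_Re_le_cmod[of x] that by (simp add: dist_norm)
    then show "1/2 \<le> cmod (1 + x)"
      using complex_Re_le_cmod[of "1 + x"] by simp
  qed
  have "cmod (f 0 z - (\<Sum>i\<le>2. f i 0 * (z - 0) ^ i / fact i)) \<le> 16 * cmod (z - 0) ^ Suc 2 / fact 2"
  proof (rule complex_Taylor[of "cball 0 (1/2)"])
    fix i x assume x: "x \<in> cball (0::complex) (1/2)" and "i \<le> (2::nat)"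
    from bnd[OF x] have nz: "1 + x \<noteq> 0" and nn: "1 + x \<notin> \<real>\<^sub>\<le>\<^sub>0"
      by (auto simp: complex_nonpos_Reals_iff)
    from \<open>i \<le> 2\<close> consider "i = 0" | "i = 1" | "i = 2" by linarith
    then show "(f i has_field_derivative f (Suc i) x) (at x within cball 0 (1/2))"
    proof cases
      case 1
      then show ?thesis unfolding f_def using nn nz
        by (auto intro!: derivative_eq_intros simp: field_simps)
    next
      case 2
      then show ?thesis unfolding f_def using nz
        by (auto intro!: derivative_eq_intros simp: power2_eq_square)
    next
      case 3
      then show ?thesis unfolding f_def using nz
        by (auto intro!: derivative_eq_intros simp: power2_eq_square power3_eq_cube)
    qed
  next
    fix x assume x: "x \<in> cball (0::complex) (1/2)"
    have "(1/2)^3 \<le> cmod (1 + x) ^ 3" using bnd[OF x] by (intro power_mono) auto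
    then have "inverse (cmod (1 + x) ^ 3) \<le> inverse ((1/2)^3)"
      by (intro le_imp_inverse_le) auto
    also have "inverse ((1/2)^3) = (8::real)" by (simp add: power3_eq_cube)
    finally have "inverse (cmod (1 + x) ^ 3) \<le> 8" .
    then show "cmod (f (Suc 2) x) \<le> 16"
      by (simp add: f_def norm_mult norm_inverse norm_power power_inverse)
  qed (use assms in auto)
  then show ?thesis
    by (simp add: f_def eval_nat_numeral)
qed

section \<open>Characteristic functions near the origin\<close>

lemma power_le_of_abs_le_1: "\<bar>u\<bar> \<le> 1 \<Longrightarrow> m \<le> k \<Longrightarrow> \<bar>u::real\<bar> ^ k \<le> \<bar>u\<bar> ^ m"
  by (rule power_decreasing) auto

text \<open>\<open>a\<close> and \<open>b\<close> are the third and fourth cumulants times i^3/3!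
  and i^4/4!. The 3 subtracted in \<open>b\<close> comes from the term -z^2/2 of the logarithm at z
  = -u^2/2. The result is phrased with \<open>exp\<close> rather than \<open>Ln\<close>, so n-th
  powers can be taken without following branches.\<close>

lemma (in real_distribution) char_eq_exp_quartic:
  assumes mom: "\<And>k::nat. integrable M (\<lambda>x. x ^ k)"
    and mean: "expectation (\<lambda>x. x) = 0" and var: "expectation (\<lambda>x. x\<^sup>2) = 1"
  defines "a \<equiv> - \<i> * expectation (\<lambda>x. x ^ 3) / 6"
    and "b \<equiv> complex_of_real ((expectation (\<lambda>x. x ^ 4) - 3) / 24)"
  obtains K \<delta> where "0 < \<delta>" "\<delta> \<le> 1" "0 \<le> K"
    "\<And>u. \<bar>u\<bar> \<le> \<delta> \<Longrightarrow> \<exists>R. cmod R \<le> K * \<bar>u\<bar> ^ 5 \<and>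
       char M u = exp (- of_real (u\<^sup>2 / 2) + a * u ^ 3 + b * u ^ 4 + R)"
proof -
  define m4 where "m4 = expectation (\<lambda>x. x ^ 4)"
  define C where "C = expectation (\<lambda>x. \<bar>x\<bar> ^ 5) / 120"
  have abs_int: "integrable M (\<lambda>x. \<bar>x\<bar> ^ k)" for k
    using integrable_abs[OF mom[of k]] by (simp add: power_abs)
  have C: "C \<ge> 0" unfolding C_def by (intro divide_nonneg_pos integral_nonneg_AE) auto
  have [simp]: "prob UNIV = 1"
    by (metis prob_space space_eq_univ)
  define q where "q u = - of_real (u\<^sup>2 / 2) + a * u ^ 3 + of_real (m4 / 24) * u ^ 4" for u :: real
  have approx: "cmod (char M u - 1 - q u) \<le> C * \<bar>u\<bar> ^ 5" for u
  proof -
    have "(\<Sum>k\<le>4. ((\<i> * u)^k / fact k) * expectation (\<lambda>x. x^k)) = 1 + q u"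
      using mean var by (simp add: eval_nat_numeral q_def a_def m4_def field_simps)
    then have "cmod (char M u - 1 - q u) = cmod (char M u - (\<Sum>k\<le>4. ((\<i> * u)^k / fact k) * expectation (\<lambda>x. x^k)))"
      by (simp add: algebra_simps)
    also have "\<dots> \<le> (\<bar>u\<bar>^4 / fact (Suc 4)) * expectation (\<lambda>x. min (2 * \<bar>x\<bar>^4 * Suc 4) (\<bar>u\<bar> * \<bar>x\<bar>^Suc 4))"
      by (rule char_approx2) (rule mom)
    \<comment> \<open>Of the two entries of the minimum, the second is kept: it has the extra factor
      \<open>\<bar>u\<bar>\<close> and yields the order 5.\<close>
    also have "\<dots> \<le> (\<bar>u\<bar>^4 / fact (Suc 4)) * expectation (\<lambda>x. \<bar>u\<bar> * \<bar>x\<bar>^Suc 4)"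
    proof (intro mult_left_mono integral_mono)
      show int: "integrable M (\<lambda>x. \<bar>u\<bar> * \<bar>x\<bar>^Suc 4)" by (intro integrable_mult_right abs_int)
      show "integrable M (\<lambda>x. min (2 * \<bar>x\<bar>^4 * Suc 4) (\<bar>u\<bar> * \<bar>x\<bar>^Suc 4))"
        by (intro integrable_min int integrable_mult_left integrable_mult_right abs_int)
    qed auto
    also have "\<dots> = C * \<bar>u\<bar> ^ 5"
      by (simp add: C_def eval_nat_numeral)
    finally show ?thesis .
  qed
  define K3 where "K3 = cmod a + \<bar>m4\<bar> / 24 + C"
  define K2 where "K2 = 1/2 + K3"
  have K3: "K3 \<ge> 0" and K2: "K2 > 0" using C by (auto simp: K3_def K2_def add_nonneg_nonneg add_pos_nonneg)
  define K where "K = 8 * K2 ^ 3 + C + K3 * (K2 + 1/2) / 2"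
  \<comment> \<open>This radius forces \<open>cmod z \<le> 1/2\<close>, as
    \<open>Ln_approx_quadratic\<close> demands.\<close>
  define \<delta> where "\<delta> = min 1 (1 / (2 * K2))"
  show ?thesis
  proof (rule that[of \<delta> K])
    show "0 < \<delta>" "\<delta> \<le> 1" "0 \<le> K" using K2 K3 C by (auto simp: \<delta>_def K_def)
    fix u :: real assume u: "\<bar>u\<bar> \<le> \<delta>"
    then have u1: "\<bar>u\<bar> \<le> 1" and u2: "K2 * \<bar>u\<bar> \<le> 1/2" using K2 by (auto simp: \<delta>_def field_simps)
    note pw = power_le_of_abs_le_1[OF u1]
    define z where "z = char M u - 1"
    have h3: "cmod (z + of_real (u\<^sup>2 / 2)) \<le> K3 * \<bar>u\<bar> ^ 3"
    proof -
      have "z + of_real (u\<^sup>2 / 2) = (z - q u) + (a * u ^ 3 + of_real (m4 / 24) * u ^ 4)"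
        by (simp add: q_def)
      also have "cmod \<dots> \<le> cmod (z - q u) + (cmod (a * u ^ 3) + cmod (of_real (m4 / 24) * u ^ 4))"
        by (intro norm_triangle_mono norm_triangle_ineq order_refl)
      also have "\<dots> \<le> C * \<bar>u\<bar> ^ 5 + (cmod a * \<bar>u\<bar> ^ 3 + \<bar>m4\<bar> / 24 * \<bar>u\<bar> ^ 4)"
        using approx[of u] by (simp add: norm_mult norm_power z_def norm_divide)
      also have "\<dots> \<le> C * \<bar>u\<bar> ^ 3 + (cmod a * \<bar>u\<bar> ^ 3 + \<bar>m4\<bar> / 24 * \<bar>u\<bar> ^ 3)"
        using C by (intro add_mono mult_left_mono pw order_refl) auto
      finally show ?thesis by (simp add: K3_def algebra_simps)
    qed
    have h2: "cmod z \<le> K2 * \<bar>u\<bar> ^ 2"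
    proof -
      have "cmod z \<le> cmod (z + of_real (u\<^sup>2 / 2)) + cmod (of_real (u\<^sup>2 / 2))"
        using norm_triangle_ineq4[of "z + of_real (u\<^sup>2 / 2)" "of_real (u\<^sup>2 / 2)"] by simp
      also have "\<dots> \<le> K3 * \<bar>u\<bar> ^ 2 + 1/2 * \<bar>u\<bar> ^ 2"
        using h3 mult_left_mono[OF pw[of 2 3] K3] by (intro add_mono) (auto simp: norm_mult norm_power norm_divide)
      finally show ?thesis by (simp add: K2_def algebra_simps)
    qed
    have "K2 * \<bar>u\<bar> ^ 2 \<le> K2 * \<bar>u\<bar> ^ 1" using K2 by (intro mult_left_mono pw) auto
    with h2 u2 have z_half: "cmod z \<le> 1/2" by simp
    then have "z \<noteq> -1" by auto
    then have "1 + z \<noteq> 0" by (simp add: add_eq_0_iff)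
    define R where "R = Ln (1 + z) - (- of_real (u\<^sup>2 / 2) + a * u ^ 3 + b * u ^ 4)"
    have "char M u = exp (Ln (1 + z))" using \<open>1 + z \<noteq> 0\<close> by (simp add: z_def)
    then have eq: "char M u = exp (- of_real (u\<^sup>2 / 2) + a * u ^ 3 + b * u ^ 4 + R)"
      by (simp add: R_def)
    \<comment> \<open>\<open>q\<close> has fourth-order coefficient m4/24, while \<open>b\<close>
      also contains -1/8. The difference u^4/8 joins -z^2/2 and factors as a difference of squares:
      since z is close to -u^2/2, one factor is O(u^3) and the other O(u^2). The three summands of
      \<open>K\<close> bound the three terms.\<close>
    have "R = (Ln (1 + z) - (z - z\<^sup>2 / 2)) + (z - q u) - (z + of_real (u\<^sup>2 / 2)) * (z - of_real (u\<^sup>2 / 2)) / 2"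
      by (simp add: R_def q_def b_def m4_def field_simps power2_eq_square eval_nat_numeral)
    also have "cmod \<dots> \<le> cmod (Ln (1 + z) - (z - z\<^sup>2 / 2)) + cmod (z - q u)
        + cmod ((z + of_real (u\<^sup>2 / 2)) * (z - of_real (u\<^sup>2 / 2)) / 2)"
      by (intro norm_triangle_mono order_trans[OF norm_triangle_ineq4] add_mono norm_triangle_ineq order_refl)
    also have "\<dots> \<le> 8 * K2 ^ 3 * \<bar>u\<bar> ^ 5 + C * \<bar>u\<bar> ^ 5 + K3 * (K2 + 1/2) / 2 * \<bar>u\<bar> ^ 5"
    proof (intro add_mono)
      have "cmod (Ln (1 + z) - (z - z\<^sup>2 / 2)) \<le> 8 * cmod z ^ 3"
        by (rule Ln_approx_quadratic[OF z_half])
      also have "\<dots> \<le> 8 * (K2 * \<bar>u\<bar> ^ 2) ^ 3" using h2 by (intro mult_left_mono power_mono) auto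
      also have "\<dots> = 8 * K2 ^ 3 * \<bar>u\<bar> ^ 6" by (simp add: power_mult_distrib flip: power_mult)
      also have "\<dots> \<le> 8 * K2 ^ 3 * \<bar>u\<bar> ^ 5" using K2 by (intro mult_left_mono pw) auto
      finally show "cmod (Ln (1 + z) - (z - z\<^sup>2 / 2)) \<le> 8 * K2 ^ 3 * \<bar>u\<bar> ^ 5" .
      show "cmod (z - q u) \<le> C * \<bar>u\<bar> ^ 5" using approx[of u] by (simp add: z_def)
      have "cmod (z - of_real (u\<^sup>2 / 2)) \<le> cmod z + cmod (of_real (u\<^sup>2 / 2))" by (rule norm_triangle_ineq4)
      also have "\<dots> \<le> (K2 + 1/2) * \<bar>u\<bar> ^ 2" using h2 by (simp add: algebra_simps norm_divide norm_power)
      finally have "cmod (z + of_real (u\<^sup>2 / 2)) * cmod (z - of_real (u\<^sup>2 / 2)) \<le> (K3 * \<bar>u\<bar> ^ 3) * ((K2 + 1/2) * \<bar>u\<bar> ^ 2)"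
        using h3 K3 by (intro mult_mono) auto
      also have "\<dots> = K3 * (K2 + 1/2) * \<bar>u\<bar> ^ 5" by (simp add: eval_nat_numeral)
      finally show "cmod ((z + of_real (u\<^sup>2 / 2)) * (z - of_real (u\<^sup>2 / 2)) / 2) \<le> K3 * (K2 + 1/2) / 2 * \<bar>u\<bar> ^ 5"
        by (simp add: norm_mult norm_divide)
    qed
    also have "\<dots> = K * \<bar>u\<bar> ^ 5" by (simp add: K_def algebra_simps)
    finally show "\<exists>R. cmod R \<le> K * \<bar>u\<bar> ^ 5 \<and>
       char M u = exp (- of_real (u\<^sup>2 / 2) + a * u ^ 3 + b * u ^ 4 + R)"
      using eq by blast
  qed
qed

text \<open>With \<open>c\<close> of order n^(-1/2) and \<open>d\<close> of order 1/n, the bracket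
  collects the terms of exp(c (it)^3 + d (it)^4) up to order 1/n.\<close>

definition edgeworth_char :: "real \<Rightarrow> real \<Rightarrow> real \<Rightarrow> complex" where
  "edgeworth_char c d t =
     of_real (exp (- (t\<^sup>2 / 2))) *
       (1 + of_real c * (\<i> * t) ^ 3 + of_real d * (\<i> * t) ^ 4 + of_real (c\<^sup>2 / 2) * (\<i> * t) ^ 6)"

text \<open>With u = t / sqrt n the power is exp(-t^2/2) exp(w), where |w| <= t^2/4 on the given
  range. Replacing exp(w) by its quadratic expansion therefore loses at most half of the Gaussian
  exponent, which leaves exp(-t^2/4). The powers 5, 7, 9 of |t| come from the remainder in the
  exponent, from truncating w^2, and from the cubic Taylor term.\<close>

lemma (in real_distribution) char_power_edgeworth:
  assumes mom: "\<And>k::nat. integrable M (\<lambda>x. x ^ k)"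
    and mean: "expectation (\<lambda>x. x) = 0" and var: "expectation (\<lambda>x. x\<^sup>2) = 1"
  defines "c \<equiv> \<lambda>n. expectation (\<lambda>x. x ^ 3) / (6 * sqrt (real n))"
    and "d \<equiv> \<lambda>n. (expectation (\<lambda>x. x ^ 4) - 3) / (24 * real n)"
  obtains K \<delta> where "0 < \<delta>" "0 \<le> K"
    "\<And>n t. 0 < n \<Longrightarrow> \<bar>t\<bar> \<le> \<delta> * sqrt (real n) \<Longrightarrow>
       cmod (char M (t / sqrt n) ^ n - edgeworth_char (c n) (d n) t)
         \<le> K / (real n * sqrt n) * ((\<bar>t\<bar> ^ 5 + \<bar>t\<bar> ^ 7 + \<bar>t\<bar> ^ 9) * exp (- t\<^sup>2 / 4))"
proof -
  define a where "a = - \<i> * expectation (\<lambda>x. x ^ 3) / 6"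
  define b where "b = complex_of_real ((expectation (\<lambda>x. x ^ 4) - 3) / 24)"
  obtain K0 \<delta>0 where \<delta>0: "0 < \<delta>0" "\<delta>0 \<le> 1" and K0: "0 \<le> K0"
    and exp: "\<And>u. \<bar>u\<bar> \<le> \<delta>0 \<Longrightarrow> \<exists>R. cmod R \<le> K0 * \<bar>u\<bar> ^ 5 \<and>
       char M u = exp (- of_real (u\<^sup>2 / 2) + a * u ^ 3 + b * u ^ 4 + R)"
    by (rule char_eq_exp_quartic[OF mom mean var, folded a_def b_def]) (rule that; assumption)
  define L where "L = cmod a + cmod b + K0 + 1"
  have L: "0 < L" "cmod a \<le> L" "cmod b + K0 \<le> L" "K0 \<le> L" using K0 by (auto simp: L_def add_nonneg_pos)
  \<comment> \<open>The bound 1/(4L) is what turns |w| <= n L |u|^3 into |w| <= t^2/4.\<close>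
  define \<delta> where "\<delta> = min \<delta>0 (1 / (4 * L))"
  show ?thesis
  proof (rule that[of \<delta> "L + L\<^sup>2 + L ^ 3"])
    show "0 < \<delta>" "0 \<le> L + L\<^sup>2 + L ^ 3" using \<delta>0 L by (auto simp: \<delta>_def)
    fix n :: nat and t :: real assume n: "0 < n" and t: "\<bar>t\<bar> \<le> \<delta> * sqrt n"
    define u where "u = t / sqrt n"
    define N where "N = real n"
    have N: "N > 0" using n by (simp add: N_def)
    have "\<bar>u\<bar> \<le> \<delta>" using t n by (simp add: u_def field_simps)
    then have u: "\<bar>u\<bar> \<le> \<delta>0" "\<bar>u\<bar> \<le> 1" and Lu: "L * \<bar>u\<bar> \<le> 1/4"
      using \<delta>0 L by (auto simp: \<delta>_def field_simps)
    note pw = power_le_of_abs_le_1[OF u(2)]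
    have tu: "t = u * sqrt N" using n by (simp add: u_def N_def)
    have t2: "t\<^sup>2 = N * u\<^sup>2" using N by (simp add: tu power_mult_distrib)
    obtain R where R: "cmod R \<le> K0 * \<bar>u\<bar> ^ 5"
      and chR: "char M u = exp (- of_real (u\<^sup>2 / 2) + a * u ^ 3 + b * u ^ 4 + R)"
      using exp[OF u(1)] by blast
    define w where "w = N * (a * u ^ 3 + b * u ^ 4 + R)"
    define A where "A = N * (a * u ^ 3)"
    have pow: "char M u ^ n = exp (- (t\<^sup>2 / 2)) * exp w"
    proof -
      have "char M u ^ n = exp (of_nat n * (- of_real (u\<^sup>2 / 2) + a * u ^ 3 + b * u ^ 4 + R))"
        unfolding chR by (rule exp_of_nat_mult[symmetric])
      also have "of_nat n * (- of_real (u\<^sup>2 / 2) + a * u ^ 3 + b * u ^ 4 + R) = of_real (- (t\<^sup>2 / 2)) + w"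
        by (simp add: w_def t2 N_def algebra_simps)
      finally show ?thesis by (simp only: exp_add exp_of_real)
    qed
    have edge: "edgeworth_char (c n) (d n) t = exp (- (t\<^sup>2 / 2)) * (1 + N * (a * u ^ 3 + b * u ^ 4) + A\<^sup>2 / 2)"
    proof -
      have s: "sqrt N ^ 2 = N" "sqrt N ^ 3 = N * sqrt N" "sqrt N ^ 4 = N\<^sup>2" "sqrt N ^ 6 = N ^ 3"
        using N real_sqrt_power_even[of 4 N] real_sqrt_power_even[of 6 N] by (auto simp: power3_eq_cube)
      have i_cube: "\<i> ^ 3 = - \<i>" by (simp add: power3_eq_cube)
      have e3: "of_real (c n) * (\<i> * t) ^ 3 = N * (a * u ^ 3)"
      proof -
        have "c n * (\<i> * t) ^ 3 = of_real (c n * sqrt N ^ 3) * (- \<i> * u ^ 3)"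
          by (simp add: tu power_mult_distrib i_cube)
        also have "c n * sqrt N ^ 3 = N * expectation (\<lambda>x. x ^ 3) / 6"
          unfolding s c_def N_def[symmetric] using N by (simp add: field_simps)
        finally show ?thesis by (simp add: a_def)
      qed
      have e4: "of_real (d n) * (\<i> * t) ^ 4 = N * (b * u ^ 4)"
      proof -
        have "d n * (\<i> * t) ^ 4 = of_real (d n * sqrt N ^ 4) * u ^ 4"
          by (simp add: tu power_mult_distrib)
        also have "d n * sqrt N ^ 4 = N * ((expectation (\<lambda>x. x ^ 4) - 3) / 24)"
          unfolding s d_def N_def[symmetric] using N by (simp add: field_simps power2_eq_square)
        finally show ?thesis by (simp add: b_def)
      qed
      have "of_real ((c n)\<^sup>2 / 2) * (\<i> * t) ^ 6 = (of_real (c n) * (\<i> * t) ^ 3)\<^sup>2 / 2"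
        by (simp add: power_mult_distrib flip: power_mult)
      then have e6: "of_real ((c n)\<^sup>2 / 2) * (\<i> * t) ^ 6 = A\<^sup>2 / 2"
        by (simp only: e3 A_def)
      show ?thesis
        by (simp only: edgeworth_char_def e3 e4 e6 distrib_left add.assoc)
    qed
    have w3: "cmod w \<le> N * L * \<bar>u\<bar> ^ 3"
    proof -
      have "cmod (a * u ^ 3 + b * u ^ 4 + R) \<le> cmod a * \<bar>u\<bar> ^ 3 + cmod b * \<bar>u\<bar> ^ 4 + K0 * \<bar>u\<bar> ^ 5"
        using R by (intro norm_triangle_mono) (auto simp: norm_mult norm_power)
      also have "\<dots> \<le> cmod a * \<bar>u\<bar> ^ 3 + cmod b * \<bar>u\<bar> ^ 3 + K0 * \<bar>u\<bar> ^ 3"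
        using K0 by (intro add_mono mult_left_mono pw) auto
      also have "\<dots> \<le> L * \<bar>u\<bar> ^ 3" by (simp add: L_def algebra_simps)
      finally show ?thesis using N by (simp add: w_def norm_mult)
    qed
    also have "N * L * \<bar>u\<bar> ^ 3 = N * \<bar>u\<bar>\<^sup>2 * (L * \<bar>u\<bar>)" by (simp add: eval_nat_numeral)
    also have "\<dots> \<le> N * \<bar>u\<bar>\<^sup>2 * (1/4)" using N Lu by (intro mult_left_mono) auto
    finally have w_small: "cmod w \<le> t\<^sup>2 / 4" by (simp add: t2)
    define P where "P = (L + L\<^sup>2 + L ^ 3) * (N * \<bar>u\<bar> ^ 5 + N\<^sup>2 * \<bar>u\<bar> ^ 7 + N ^ 3 * \<bar>u\<bar> ^ 9)"
    have E1: "cmod (exp w - (1 + w + w\<^sup>2 / 2)) \<le> exp (t\<^sup>2 / 4) * (L ^ 3 * (N ^ 3 * \<bar>u\<bar> ^ 9))"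
    proof -
      have "cmod (exp w - (\<Sum>k\<le>2. w ^ k / fact k)) \<le> exp \<bar>Re w\<bar> * cmod w ^ Suc 2 / fact 2"
        by (rule Taylor_exp)
      also have "\<dots> \<le> exp \<bar>Re w\<bar> * cmod w ^ 3" by (simp add: field_simps eval_nat_numeral)
      also have "\<dots> \<le> exp (t\<^sup>2 / 4) * (N * L * \<bar>u\<bar> ^ 3) ^ 3"
        using w3 w_small abs_Re_le_cmod[of w] by (intro mult_mono power_mono) auto
      finally show ?thesis by (simp add: eval_nat_numeral power_mult_distrib algebra_simps)
    qed
    have E2: "cmod (N * R) \<le> exp (t\<^sup>2 / 4) * (L * (N * \<bar>u\<bar> ^ 5))"
    proof -
      have "cmod (N * R) \<le> 1 * (L * (N * \<bar>u\<bar> ^ 5))"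
        using R N L mult_right_mono[OF L(4), of "\<bar>u\<bar> ^ 5"] by (auto simp: norm_mult mult.left_commute)
      also have "\<dots> \<le> exp (t\<^sup>2 / 4) * (L * (N * \<bar>u\<bar> ^ 5))"
        using N L by (intro mult_right_mono) auto
      finally show ?thesis .
    qed
    have E3: "cmod ((w\<^sup>2 - A\<^sup>2) / 2) \<le> exp (t\<^sup>2 / 4) * (L\<^sup>2 * (N\<^sup>2 * \<bar>u\<bar> ^ 7))"
    proof -
      have "cmod (b * u ^ 4 + R) \<le> cmod b * \<bar>u\<bar> ^ 4 + K0 * \<bar>u\<bar> ^ 5"
        using R by (intro norm_triangle_mono) (auto simp: norm_mult norm_power)
      also have "\<dots> \<le> cmod b * \<bar>u\<bar> ^ 4 + K0 * \<bar>u\<bar> ^ 4"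
        using K0 by (intro add_mono mult_left_mono pw) auto
      also have "\<dots> \<le> L * \<bar>u\<bar> ^ 4" by (simp add: L_def algebra_simps)
      finally have "cmod (N * (b * u ^ 4 + R)) \<le> N * L * \<bar>u\<bar> ^ 4" using N by (simp add: norm_mult)
      moreover have "N * (b * u ^ 4 + R) = w - A" by (simp add: w_def A_def algebra_simps)
      ultimately have m: "cmod (w - A) \<le> N * L * \<bar>u\<bar> ^ 4" by simp
      have "cmod A \<le> N * L * \<bar>u\<bar> ^ 3"
        using N mult_right_mono[OF L(2), of "\<bar>u\<bar> ^ 3"] by (simp add: A_def norm_mult norm_power)
      then have p: "cmod (w + A) \<le> 2 * (N * L * \<bar>u\<bar> ^ 3)"
        using norm_triangle_ineq[of w A] w3 by linarith
      have "cmod ((w\<^sup>2 - A\<^sup>2) / 2) = cmod (w - A) * cmod (w + A) / 2"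
        by (simp add: norm_divide square_diff_square_factored power2_eq_square norm_mult mult.commute)
      also have "\<dots> \<le> (N * L * \<bar>u\<bar> ^ 4) * (2 * (N * L * \<bar>u\<bar> ^ 3)) / 2"
        using m p N L by (intro divide_right_mono mult_mono) auto
      also have "\<dots> = 1 * (L\<^sup>2 * (N\<^sup>2 * \<bar>u\<bar> ^ 7))" by (simp add: eval_nat_numeral)
      also have "\<dots> \<le> exp (t\<^sup>2 / 4) * (L\<^sup>2 * (N\<^sup>2 * \<bar>u\<bar> ^ 7))"
        using N L by (intro mult_right_mono) auto
      finally show ?thesis .
    qed
    \<comment> \<open>The approximation contains the linear part of \<open>w\<close> without
      \<open>N * R\<close>, and the square of the leading part \<open>A\<close> alone. The three
      differences are exactly \<open>E1\<close>, \<open>E2\<close> and \<open>E3\<close>.\<close>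
    have "char M u ^ n - edgeworth_char (c n) (d n) t
        = exp (- (t\<^sup>2 / 2)) * ((exp w - (1 + w + w\<^sup>2 / 2)) + N * R + (w\<^sup>2 - A\<^sup>2) / 2)"
      unfolding pow edge by (simp add: w_def field_simps)
    also have "cmod \<dots> = exp (- (t\<^sup>2 / 2)) * cmod ((exp w - (1 + w + w\<^sup>2 / 2)) + N * R + (w\<^sup>2 - A\<^sup>2) / 2)"
      by (simp add: norm_mult)
    also have "\<dots> \<le> exp (- (t\<^sup>2 / 2)) * (exp (t\<^sup>2 / 4) * (L ^ 3 * (N ^ 3 * \<bar>u\<bar> ^ 9))
        + exp (t\<^sup>2 / 4) * (L * (N * \<bar>u\<bar> ^ 5)) + exp (t\<^sup>2 / 4) * (L\<^sup>2 * (N\<^sup>2 * \<bar>u\<bar> ^ 7)))"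
      by (intro mult_left_mono norm_triangle_mono E1 E2 E3) auto
    also have "\<dots> = exp (- (t\<^sup>2 / 2) + t\<^sup>2 / 4) * (L ^ 3 * (N ^ 3 * \<bar>u\<bar> ^ 9)
        + L * (N * \<bar>u\<bar> ^ 5) + L\<^sup>2 * (N\<^sup>2 * \<bar>u\<bar> ^ 7))"
      unfolding exp_add by (simp add: algebra_simps)
    also have "\<dots> \<le> exp (- (t\<^sup>2 / 2) + t\<^sup>2 / 4) * P"
    proof (rule mult_left_mono)
      have "x * p + y * q + z * r \<le> (y + z + x) * (q + r + p)"
        if "0 \<le> x" "0 \<le> y" "0 \<le> z" "0 \<le> p" "0 \<le> q" "0 \<le> r" for x y z p q r :: real
        using that by (simp add: algebra_simps add_nonneg_nonneg)
      then show "L ^ 3 * (N ^ 3 * \<bar>u\<bar> ^ 9) + L * (N * \<bar>u\<bar> ^ 5) + L\<^sup>2 * (N\<^sup>2 * \<bar>u\<bar> ^ 7) \<le> P"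
        unfolding P_def using N L by simp
    qed auto
    also have "- (t\<^sup>2 / 2) + t\<^sup>2 / 4 = - t\<^sup>2 / 4" by simp
    also have "P = (L + L\<^sup>2 + L ^ 3) / (N * sqrt N) * (\<bar>t\<bar> ^ 5 + \<bar>t\<bar> ^ 7 + \<bar>t\<bar> ^ 9)"
    \<comment> \<open>All three terms have the form N^j |u|^(2j+3) with j = 1, 2, 3, which equals
      |t|^(2j+3) / N^(3/2). This is the source of the common factor n^(-3/2).\<close>
    proof -
      define s where "s = sqrt N"
      have s: "s > 0" "N = s ^ 2" using N by (auto simp: s_def)
      have tu: "\<bar>t\<bar> = s * \<bar>u\<bar>" using s(1) by (simp add: tu s_def abs_mult)
      have "N * \<bar>u\<bar> ^ 5 = \<bar>t\<bar> ^ 5 / (N * s)" "N\<^sup>2 * \<bar>u\<bar> ^ 7 = \<bar>t\<bar> ^ 7 / (N * s)"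
           "N ^ 3 * \<bar>u\<bar> ^ 9 = \<bar>t\<bar> ^ 9 / (N * s)"
      proof -
        have canc: "x * v = (s\<^sup>2 * s) * x * v / (s\<^sup>2 * s)" for x v
          using s(1) by simp
        have p: "s ^ 5 = (s\<^sup>2 * s) * s ^ 2" "s ^ 7 = (s\<^sup>2 * s) * s ^ 4" "s ^ 9 = (s\<^sup>2 * s) * s ^ 6"
          by (simp_all add: eval_nat_numeral mult.assoc)
        have q: "(s\<^sup>2)\<^sup>2 = s ^ 4" "(s\<^sup>2) ^ 3 = s ^ 6"
          by (simp_all flip: power_mult)
        show "N * \<bar>u\<bar> ^ 5 = \<bar>t\<bar> ^ 5 / (N * s)"
          by (simp only: s(2) tu power_mult_distrib p) (rule canc)
        show "N\<^sup>2 * \<bar>u\<bar> ^ 7 = \<bar>t\<bar> ^ 7 / (N * s)"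
          by (simp only: s(2) tu power_mult_distrib p q) (rule canc)
        show "N ^ 3 * \<bar>u\<bar> ^ 9 = \<bar>t\<bar> ^ 9 / (N * s)"
          by (simp only: s(2) tu power_mult_distrib p q) (rule canc)
      qed
      then show ?thesis unfolding P_def s_def[symmetric]
        by (simp add: add_divide_distrib ring_distribs)
    qed
    finally show "cmod (char M (t / sqrt n) ^ n - edgeworth_char (c n) (d n) t)
         \<le> (L + L\<^sup>2 + L ^ 3) / (real n * sqrt n) * ((\<bar>t\<bar> ^ 5 + \<bar>t\<bar> ^ 7 + \<bar>t\<bar> ^ 9) * exp (- t\<^sup>2 / 4))"
      by (simp add: u_def N_def mult_ac)
  qed
qed

section \<open>Fourier transforms of Hermite functions\<close>

text \<open>With y = t^2/4, the inequality (1 + y/k)^k <= exp y bounds y^k exp(-y) by k^k. Odd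
  powers are reduced to even ones by v <= 1 + v^2.\<close>

lemma abs_power_gauss_bounded:
  obtains C where "0 \<le> C" "\<And>t::real. \<bar>t\<bar> ^ k * exp (- t\<^sup>2 / 4) \<le> C"
proof (rule that[of "1 + 4 ^ k * real k ^ k"])
  fix t :: real
  define y where "y = t\<^sup>2 / 4"
  have y: "0 \<le> y" by (simp add: y_def)
  have "y ^ k \<le> real k ^ k * exp y"
  proof (cases "k = 0")
    case False
    have "(y / k) ^ k \<le> (1 + y / k) ^ k" using y by (intro power_mono) auto
    also have "\<dots> \<le> exp y" using y False by (intro exp_ge_one_plus_x_over_n_power_n) auto
    finally show ?thesis using False by (simp add: power_divide field_simps)
  qed (use y in simp)
  then have yk: "y ^ k * exp (- y) \<le> real k ^ k"
    by (simp add: exp_minus field_simps)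
  have "\<bar>t\<bar> ^ k \<le> 1 + (\<bar>t\<bar> ^ k)\<^sup>2"
    using zero_le_power2[of "\<bar>t\<bar> ^ k - 1/2"] by (simp add: power2_eq_square algebra_simps)
  also have "(\<bar>t\<bar> ^ k)\<^sup>2 = (t\<^sup>2) ^ k" by (simp add: power_even_abs flip: power_mult) (simp add: mult.commute)
  also have "t\<^sup>2 = 4 * y" by (simp add: y_def)
  finally have "\<bar>t\<bar> ^ k * exp (- y) \<le> (1 + (4 * y) ^ k) * exp (- y)"
    by (rule mult_right_mono) simp
  also have "\<dots> = exp (- y) + 4 ^ k * (y ^ k * exp (- y))" by (simp add: power_mult_distrib algebra_simps)
  also have "\<dots> \<le> 1 + 4 ^ k * real k ^ k"
    using y by (intro add_mono mult_left_mono yk) auto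
  finally show "\<bar>t\<bar> ^ k * exp (- t\<^sup>2 / 4) \<le> 1 + 4 ^ k * real k ^ k" by (simp add: y_def)
qed simp

text \<open>This is the k-th derivative of exp(-x^2/2) in x, that is (-1)^k He_k(x) exp(-x^2/2) with
  the probabilists' Hermite polynomial He_k.\<close>

definition gauss_moment :: "nat \<Rightarrow> real \<Rightarrow> complex" where
  "gauss_moment k x = (CLBINT t. (\<i> * t) ^ k * iexp (t * x) * std_normal_density t)"

lemma integrable_gauss_moment:
  "integrable lborel (\<lambda>t::real. (\<i> * t) ^ k * iexp (t * x) * std_normal_density t)"
proof (rule Bochner_Integration.integrable_bound[OF integrable_std_normal_moment_abs[of k]])
  show "AE t in lborel. norm ((\<i> * t) ^ k * iexp (t * x) * std_normal_density t) \<le>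
      norm (std_normal_density t * \<bar>t\<bar> ^ k)"
    by (auto simp: norm_mult norm_power abs_mult power_abs)
qed simp

lemma gauss_moment_0: "gauss_moment 0 x = exp (- x\<^sup>2 / 2)"
proof -
  have "gauss_moment 0 x = char std_normal_distribution x"
    unfolding char_def gauss_moment_def
    by (subst integral_density) (auto simp: scaleR_conv_of_real mult_ac)
  then show ?thesis by (simp add: char_std_normal_distribution)
qed

lemma std_normal_density_abs_power_tendsto_0:
  assumes "F \<le> at_infinity"
  shows "((\<lambda>t. \<bar>t\<bar> ^ k * std_normal_density t) \<longlongrightarrow> 0) F"
proof -
  obtain C where C: "0 \<le> C" "\<And>t::real. \<bar>t\<bar> ^ Suc k * exp (- t\<^sup>2 / 4) \<le> C"
    by (rule abs_power_gauss_bounded[of "Suc k"]) (rule that; assumption)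
  have "((\<lambda>t. \<bar>t\<bar> ^ k * std_normal_density t) \<longlongrightarrow> 0) at_infinity"
  proof (rule Lim_null_comparison)
    have "norm (\<bar>t\<bar> ^ k * std_normal_density t) \<le> norm (C * inverse t)" if "t \<noteq> 0" for t
    proof -
      have "std_normal_density t \<le> exp (- t\<^sup>2 / 2)"
        unfolding std_normal_density_def using pi_ge_two by (intro mult_left_le_one_le) auto
      also have "\<dots> \<le> exp (- t\<^sup>2 / 4)" by simp
      finally have "\<bar>t\<bar> ^ Suc k * std_normal_density t \<le> \<bar>t\<bar> ^ Suc k * exp (- t\<^sup>2 / 4)"
        by (intro mult_left_mono) auto
      also have "\<dots> \<le> C" by (rule C)
      finally have "\<bar>t\<bar> * (\<bar>t\<bar> ^ k * std_normal_density t) \<le> C" by (simp add: mult_ac)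
      then show ?thesis using that C(1) by (simp add: abs_mult field_simps)
    qed
    then show "\<forall>\<^sub>F t in at_infinity. norm (\<bar>t\<bar> ^ k * std_normal_density t) \<le> norm (C * inverse t)"
      by (auto simp: eventually_at_infinity intro!: exI[of _ 1])
    show "((\<lambda>t. norm (C * inverse t)) \<longlongrightarrow> 0) at_infinity"
      by (intro tendsto_norm_zero tendsto_mult_right_zero tendsto_inverse_0)
  qed
  then show ?thesis using assms by (rule tendsto_mono[rotated])
qed

lemma DERIV_std_normal_density:
  "(std_normal_density has_real_derivative - x * std_normal_density x) (at x)"
  unfolding std_normal_density_def[abs_def]
  by (auto intro!: derivative_eq_intros simp: field_simps)

text \<open>Integration by parts, as \<open>(it)\<^sup>k exp(itx - t\<^sup>2/2)\<close> vanishes at infinity.\<close>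

lemma gauss_moment_Suc:
  "gauss_moment (Suc k) x = - x * gauss_moment k x - k * gauss_moment (k - 1) x"
proof -
  define F where "F t = - \<i> * ((\<i> * t) ^ k * iexp (t * x) * std_normal_density t)" for t :: real
  \<comment> \<open>\<open>f\<close> is the derivative of \<open>F\<close>; the factor -i in
    \<open>F\<close> makes the coefficients k, x and 1. For \<open>k = 0\<close> the truncated
    \<open>k - 1\<close> does no harm, since its term carries the factor \<open>k\<close>.\<close>
  define f where "f t = k * ((\<i> * t) ^ (k - 1) * iexp (t * x) * std_normal_density t)
     + x * ((\<i> * t) ^ k * iexp (t * x) * std_normal_density t)
     + (\<i> * t) ^ Suc k * iexp (t * x) * std_normal_density t" for t :: real
  have int: "integrable lborel f"
    unfolding f_def by (intro Bochner_Integration.integrable_add integrable_mult_right integrable_gauss_moment)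
  have cont: "isCont f t" for t
    unfolding f_def std_normal_density_def by (intro continuous_intros) auto
  have der: "(F has_vector_derivative f t) (at t)" for t
  proof -
    define r where "r = 1 / complex_of_real (sqrt (2 * pi))"
    \<comment> \<open>An extension of \<open>F\<close> to complex arguments, so that the complex
      differentiation rules apply before restricting to the real line.\<close>
    define g where "g z = - \<i> * ((\<i> * z) ^ k * exp (\<i> * (z * x)) * (r * exp (- z\<^sup>2 / 2)))" for z :: complex
    have dens: "of_real (std_normal_density s) = r * exp (- (of_real s)\<^sup>2 / 2)" for s
      by (simp add: std_normal_density_def r_def flip: exp_of_real)
    define e where "e = exp (\<i> * (of_real t * x)) * (r * exp (- (of_real t)\<^sup>2 / 2))"
    have "(g has_field_derivative - \<i> * (k * \<i> * (\<i> * t) ^ (k - 1) * e + (\<i> * t) ^ k * (\<i> * x) * e + (\<i> * t) ^ k * (- t * e)))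
        (at (of_real t))"
      unfolding g_def e_def
      by (auto intro!: derivative_eq_intros simp: algebra_simps) (cases k; simp add: algebra_simps)
    also have "- \<i> * (k * \<i> * (\<i> * t) ^ (k - 1) * e + (\<i> * t) ^ k * (\<i> * x) * e + (\<i> * t) ^ k * (- t * e)) = f t"
      by (simp add: f_def dens e_def algebra_simps)
    finally have "((\<lambda>s. g (of_real s)) has_vector_derivative f t) (at t)"
      by (rule has_vector_derivative_real_field)
    moreover have "(\<lambda>s. g (of_real s)) = F"
      by (auto simp: g_def F_def dens)
    ultimately show ?thesis by simp
  qed
  have lim: "(F \<longlongrightarrow> 0) G" if "G \<le> at_infinity" for G
  proof (rule tendsto_norm_zero_cancel)
    have "(\<lambda>t. norm (F t)) = (\<lambda>t. \<bar>t\<bar> ^ k * std_normal_density t)"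
      by (auto simp: F_def norm_mult norm_power)
    then show "((\<lambda>t. norm (F t)) \<longlongrightarrow> 0) G"
      using std_normal_density_abs_power_tendsto_0[OF that] by simp
  qed
  have "(LBINT t=-\<infinity>..\<infinity>. f t) = 0 - 0"
  proof (rule interval_integral_FTC_integrable)
    show "(F has_vector_derivative f t) (at t)" for t by (rule der)
    show "isCont f t" for t by (rule cont)
    show "set_integrable lborel (einterval (-\<infinity>) \<infinity>) f"
      using int by (simp add: set_integrable_def einterval_eq_UNIV)
    show "((F \<circ> real_of_ereal) \<longlongrightarrow> 0) (at_right (-\<infinity>))" "((F \<circ> real_of_ereal) \<longlongrightarrow> 0) (at_left \<infinity>)"
      unfolding ereal_tendsto_simps
      by (intro lim at_bot_le_at_infinity at_top_le_at_infinity)+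
  qed simp
  then have "(LBINT t. f t) = 0"
    by (simp add: interval_lebesgue_integral_def set_lebesgue_integral_def einterval_eq_UNIV)
  moreover have "(LBINT t. f t) = k * gauss_moment (k - 1) x + x * gauss_moment k x + gauss_moment (Suc k) x"
    unfolding f_def gauss_moment_def
    by (simp only: Bochner_Integration.integral_add Bochner_Integration.integrable_add
        integrable_mult_right integral_mult_right_zero integrable_gauss_moment)
  ultimately show ?thesis by (simp add: algebra_simps eq_neg_iff_add_eq_0)
qed

text \<open>The degrees 2, 3, 5 are what remains of the powers 3, 4, 6 in
  \<open>edgeworth_char\<close> after the division by it in the inversion formula.\<close>

lemma gauss_moment_values:
  fixes x :: real
  shows "gauss_moment 2 x = of_real ((x\<^sup>2 - 1) * exp (- x\<^sup>2 / 2))"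
    and "gauss_moment 3 x = of_real (- (x ^ 3 - 3 * x) * exp (- x\<^sup>2 / 2))"
    and "gauss_moment 5 x = of_real (- (x ^ 5 - 10 * x ^ 3 + 15 * x) * exp (- x\<^sup>2 / 2))"
proof -
  define E where "E = complex_of_real (exp (- x\<^sup>2 / 2))"
  note S = gauss_moment_Suc[of _ x]
  have 0: "gauss_moment 0 x = E" by (simp add: gauss_moment_0 E_def)
  have 1: "gauss_moment 1 x = - x * E" using S[of 0] 0 by simp
  have 2: "gauss_moment 2 x = (x\<^sup>2 - 1) * E"
    using S[of 1] 0 1 by (simp add: numeral_2_eq_2 algebra_simps power2_eq_square)
  have 3: "gauss_moment 3 x = - (x ^ 3 - 3 * x) * E"
    using S[of 2] 1 2 by (simp add: algebra_simps power2_eq_square power3_eq_cube)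
  have 4: "gauss_moment 4 x = (x ^ 4 - 6 * x ^ 2 + 3) * E"
    using S[of 3] 2 3 by (simp add: algebra_simps power2_eq_square power3_eq_cube power4_eq_xxxx)
  have 5: "gauss_moment 5 x = - (x ^ 5 - 10 * x ^ 3 + 15 * x) * E"
    using S[of 4] 3 4 by (simp add: algebra_simps power_numeral_reduce)
  show "gauss_moment 2 x = of_real ((x\<^sup>2 - 1) * exp (- x\<^sup>2 / 2))"
    "gauss_moment 3 x = of_real (- (x ^ 3 - 3 * x) * exp (- x\<^sup>2 / 2))"
    "gauss_moment 5 x = of_real (- (x ^ 5 - 10 * x ^ 3 + 15 * x) * exp (- x\<^sup>2 / 2))"
    unfolding 2 3 5 E_def by simp_all
qed

section \<open>Levy's inversion kernel and the inversion of the Edgeworth transform\<close>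

text \<open>At \<open>t = 0\<close> this is \<open>0\<close> and not the limit \<open>b - a\<close>.\<close>

definition inversion_kernel :: "real \<Rightarrow> real \<Rightarrow> real \<Rightarrow> complex" where
  "inversion_kernel a b t = (iexp (-(t * a)) - iexp (-(t * b))) / (\<i> * t)"

lemma inversion_kernel_measurable [measurable]: "inversion_kernel a b \<in> borel_measurable borel"
  unfolding inversion_kernel_def[abs_def] by measurable

lemma norm_inversion_kernel_le_diff: "a \<le> b \<Longrightarrow> cmod (inversion_kernel a b t) \<le> b - a"
  using Levy_Inversion_aux2[of "-b" "-a" t] by (cases "t = 0") (auto simp: inversion_kernel_def)

text \<open>Unlike the bound \<open>b - a\<close>, this one is uniform in the endpoints, so
  \<open>a\<close> may later tend to minus infinity.\<close>

lemma norm_inversion_kernel_le: "cmod (inversion_kernel a b t) \<le> 2 / \<bar>t\<bar>"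
proof -
  have "cmod (iexp (-(t * a)) - iexp (-(t * b))) \<le> cmod (iexp (-(t * a))) + cmod (iexp (-(t * b)))"
    by (rule norm_triangle_ineq4)
  also have "\<dots> = 2" by simp
  finally show ?thesis
    by (simp add: inversion_kernel_def norm_divide norm_mult divide_right_mono)
qed

lemma interval_integrable_bounded:
  fixes f :: "real \<Rightarrow> complex"
  assumes [measurable]: "f \<in> borel_measurable borel" and "\<And>t. cmod (f t) \<le> B"
  shows "interval_lebesgue_integrable lborel (ereal u) (ereal v) f"
  unfolding interval_lebesgue_integrable_def set_integrable_def
  using assms(2) by (auto intro!: integrableI_bounded_set_indicator[where B=B])

lemma norm_inversion_kernel_mult_le:
  assumes "a \<le> b" "\<And>t. cmod (f t) \<le> B"
  shows "cmod (inversion_kernel a b t * f t) \<le> (b - a) * B"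
  unfolding norm_mult using assms norm_inversion_kernel_le_diff[OF assms(1), of t]
  by (intro mult_mono) auto

text \<open>The polynomials are the Hermite polynomials of degrees 2, 3 and 5.\<close>

definition edgeworth_cdf :: "real \<Rightarrow> real \<Rightarrow> real \<Rightarrow> real" where
  "edgeworth_cdf c d x = Phi x - std_normal_density x *
     (c * (x\<^sup>2 - 1) + d * (x ^ 3 - 3 * x) + c\<^sup>2 / 2 * (x ^ 5 - 10 * x ^ 3 + 15 * x))"

lemma edgeworth_char_measurable [measurable]: "edgeworth_char c d \<in> borel_measurable borel"
  unfolding edgeworth_char_def[abs_def] by measurable

lemma norm_edgeworth_char_le:
  "cmod (edgeworth_char c d t) \<le> exp (- t\<^sup>2 / 2) * (1 + \<bar>c\<bar> * \<bar>t\<bar> ^ 3 + \<bar>d\<bar> * \<bar>t\<bar> ^ 4 + c\<^sup>2 * \<bar>t\<bar> ^ 6)"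
proof -
  have "cmod (1 + of_real c * (\<i> * t) ^ 3 + of_real d * (\<i> * t) ^ 4 + of_real (c\<^sup>2 / 2) * (\<i> * t) ^ 6)
      \<le> 1 + \<bar>c\<bar> * \<bar>t\<bar> ^ 3 + \<bar>d\<bar> * \<bar>t\<bar> ^ 4 + c\<^sup>2 * \<bar>t\<bar> ^ 6"
  proof (intro norm_triangle_mono)
    show "cmod (of_real (c\<^sup>2 / 2) * (\<i> * t) ^ 6) \<le> c\<^sup>2 * \<bar>t\<bar> ^ 6"
      unfolding norm_mult norm_power norm_of_real norm_ii by (intro mult_mono) auto
  qed (auto simp: norm_mult norm_power)
  then show ?thesis
    unfolding edgeworth_char_def norm_mult by (intro mult_mono) auto
qed

text \<open>Only exp(-t^2/4) of the Gaussian factor is used, against each monomial separately; the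
  bound is uniform in \<open>c\<close> and \<open>d\<close>. It serves with k = 0 for boundedness, k
  = 2 for integrable decay, and k = 5 for the range |t| > \<delta> sqrt n.\<close>

lemma edgeworth_char_gauss_le:
  obtains C where "0 \<le> C"
    "\<And>c d t. \<bar>c\<bar> \<le> B \<Longrightarrow> \<bar>d\<bar> \<le> B \<Longrightarrow> cmod (edgeworth_char c d t) * (1 + \<bar>t\<bar> ^ k) \<le> C"
proof -
  have "\<exists>C. \<forall>t::real. \<bar>t\<bar> ^ j * exp (- t\<^sup>2 / 4) \<le> C" for j
    by (meson abs_power_gauss_bounded)
  then obtain A where A: "\<And>j t. \<bar>t::real\<bar> ^ j * exp (- t\<^sup>2 / 4) \<le> A j" by metis
  define D where "D = A 0 + A k + B * (A 3 + A (3 + k)) + B * (A 4 + A (4 + k)) + B\<^sup>2 * (A 6 + A (6 + k))"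
  show ?thesis
  proof (rule that[of "\<bar>D\<bar>"])
    fix c d t :: real assume cd: "\<bar>c\<bar> \<le> B" "\<bar>d\<bar> \<le> B"
    define e where "e = exp (- t\<^sup>2 / 4)"
    have B: "0 \<le> B" using cd by simp
    have c2: "c\<^sup>2 \<le> B\<^sup>2" using cd power_mono[of "\<bar>c\<bar>" B 2] by simp
    have "cmod (edgeworth_char c d t) * (1 + \<bar>t\<bar> ^ k) \<le>
        (e * (1 + B * \<bar>t\<bar> ^ 3 + B * \<bar>t\<bar> ^ 4 + B\<^sup>2 * \<bar>t\<bar> ^ 6)) * (1 + \<bar>t\<bar> ^ k)"
      unfolding e_def using B c2 cd
      by (intro mult_right_mono order_trans[OF norm_edgeworth_char_le] mult_mono add_mono) auto
    also have "\<dots> = \<bar>t\<bar> ^ 0 * e + \<bar>t\<bar> ^ k * e + B * (\<bar>t\<bar> ^ 3 * e + \<bar>t\<bar> ^ (3 + k) * e)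
       + B * (\<bar>t\<bar> ^ 4 * e + \<bar>t\<bar> ^ (4 + k) * e) + B\<^sup>2 * (\<bar>t\<bar> ^ 6 * e + \<bar>t\<bar> ^ (6 + k) * e)"
      by (simp add: power_add algebra_simps)
    also have "\<dots> \<le> D"
      unfolding e_def D_def using B by (intro add_mono mult_left_mono A) auto
    finally show "cmod (edgeworth_char c d t) * (1 + \<bar>t\<bar> ^ k) \<le> \<bar>D\<bar>" by simp
  qed simp
qed

lemma edgeworth_char_bounded: obtains C where "\<And>t. cmod (edgeworth_char c d t) \<le> C"
proof -
  obtain C where "\<And>t. cmod (edgeworth_char c d t) * (1 + \<bar>t::real\<bar> ^ 0) \<le> C"
    using edgeworth_char_gauss_le[of "max \<bar>c\<bar> \<bar>d\<bar>" 0] by (metis max.cobounded1 max.cobounded2)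
  then have "cmod (edgeworth_char c d t) \<le> C / 2" for t :: real by (simp add: field_simps)
  then show ?thesis by (rule that)
qed

lemma LBINT_symmetric_tendsto:
  fixes f :: "real \<Rightarrow> complex"
  assumes "integrable lborel f"
  shows "(\<lambda>T::nat. CLBINT t=ereal (-real T)..ereal (real T). f t) \<longlonglongrightarrow> (CLBINT t. f t)"
proof -
  have [measurable]: "f \<in> borel_measurable borel" using assms by auto
  have eq: "(CLBINT t=ereal (-real T)..ereal (real T). f t) = (CLBINT t. indicator {-real T<..<real T} t *\<^sub>R f t)" for T :: nat
    by (simp add: interval_lebesgue_integral_def set_lebesgue_integral_def)
  show ?thesis unfolding eq
  proof (rule integral_dominated_convergence[where w = "\<lambda>t. norm (f t)"])
    show "integrable lborel (\<lambda>t. norm (f t))" using assms by simp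
    show "AE t in lborel. (\<lambda>T. indicator {-real T<..<real T} t *\<^sub>R f t) \<longlonglongrightarrow> f t"
    proof (intro AE_I2 tendsto_eventually)
      fix t :: real
      obtain N :: nat where "\<bar>t\<bar> < N" using reals_Archimedean2 by blast
      then show "\<forall>\<^sub>F T in sequentially. indicator {-real T<..<real T} t *\<^sub>R f t = f t"
        by (intro eventually_sequentiallyI[of N]) (auto simp: indicator_def)
    qed
  qed (auto simp: indicator_def)
qed

text \<open>The summand 1 of the bracket gives the transform of the normal law, to which Levy's
  theorem applies. The other summands are divisible by it, so the kernel loses its denominator and
  leaves absolutely integrable Hermite terms.\<close>

lemma edgeworth_inversion:
  assumes "a \<le> b"
  shows "(\<lambda>T::nat. 1 / (2 * pi) * (CLBINT t=ereal (-real T)..ereal (real T). inversion_kernel a b t * edgeworth_char c d t))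
    \<longlonglongrightarrow> of_real (edgeworth_cdf c d b - edgeworth_cdf c d a)"
proof -
  interpret N: real_distribution std_normal_distribution by (rule real_dist_normal_dist)
  define s where "s = complex_of_real (sqrt (2 * pi))"
  have s: "s \<noteq> 0" "s * s = 2 * pi" by (simp_all add: s_def flip: of_real_mult)
  have dens: "of_real (exp (- (t\<^sup>2 / 2))) = s * of_real (std_normal_density t)" for t
    using s by (simp add: std_normal_density_def s_def)
  define m where "m k y t = (\<i> * t) ^ k * iexp (t * y) * std_normal_density t" for k and y t :: real
  define h where "h t = s * (c * (m 2 (-a) t - m 2 (-b) t) + d * (m 3 (-a) t - m 3 (-b) t)
     + of_real (c\<^sup>2 / 2) * (m 5 (-a) t - m 5 (-b) t))" for t
  have int_m: "integrable lborel (m k y)" for k y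
    unfolding m_def by (rule integrable_gauss_moment)
  have int_h: "integrable lborel h"
    unfolding h_def by (intro Bochner_Integration.integrable_add integrable_mult_right
        Bochner_Integration.integrable_diff int_m)
  have ch: "char std_normal_distribution t = of_real (exp (- (t\<^sup>2 / 2)))" for t
    by (simp add: char_std_normal_distribution)
  \<comment> \<open>The kernel carries exp(-ita), hence the moments at \<open>-a\<close> and
    \<open>-b\<close>. At \<open>t = 0\<close> the kernel is 0 by convention and \<open>h\<close>
    vanishes as well, because only positive powers of t occur in it.\<close>
  have split: "inversion_kernel a b t * edgeworth_char c d t
      = inversion_kernel a b t * char std_normal_distribution t + h t" for t
  proof (cases "t = 0")
    case False
    then have "inversion_kernel a b t * (\<i> * t) ^ Suc k = (\<i> * t) ^ k * (iexp (t * (-a)) - iexp (t * (-b)))" for k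
      by (simp add: inversion_kernel_def)
    from this[of 2] this[of 3] this[of 5]
    have K: "inversion_kernel a b t * (\<i> * t) ^ 3 = (\<i> * t) ^ 2 * (iexp (t * (-a)) - iexp (t * (-b)))"
      "inversion_kernel a b t * (\<i> * t) ^ 4 = (\<i> * t) ^ 3 * (iexp (t * (-a)) - iexp (t * (-b)))"
      "inversion_kernel a b t * (\<i> * t) ^ 6 = (\<i> * t) ^ 5 * (iexp (t * (-a)) - iexp (t * (-b)))"
      by simp_all
    define E where "E = complex_of_real (std_normal_density t)"
    have alg2: "q + s * e * (c * (x * (u - v)) + d * (y * (u - v)) + f * (z * (u - v))) =
        q + s * (c * (x * u * e - x * v * e) + d * (y * u * e - y * v * e) + f * (z * u * e - z * v * e))"
      for q e c d f x y z u v :: complex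
      by (simp add: algebra_simps)
    have alg1: "k * (s * e * (1 + c * x + d * y + f * z)) = k * (s * e) + s * e * (c * (k * x) + d * (k * y) + f * (k * z))"
      for k e c x d y f z :: complex
      by (simp add: algebra_simps)
    have "inversion_kernel a b t * edgeworth_char c d t = inversion_kernel a b t * (s * E)
      + s * E * (c * (inversion_kernel a b t * (\<i> * t) ^ 3) + d * (inversion_kernel a b t * (\<i> * t) ^ 4)
       + of_real (c\<^sup>2 / 2) * (inversion_kernel a b t * (\<i> * t) ^ 6))"
      unfolding edgeworth_char_def dens E_def by (rule alg1)
    also have "\<dots> = inversion_kernel a b t * char std_normal_distribution t + h t"
      unfolding K ch dens h_def m_def E_def by (rule alg2)
    finally show ?thesis .
  qed (simp add: inversion_kernel_def h_def m_def)
  define I where "I T = (CLBINT t=ereal (-real T)..ereal (real T). inversion_kernel a b t * char std_normal_distribution t)" for T :: nat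
  define J where "J T = (CLBINT t=ereal (-real T)..ereal (real T). h t)" for T :: nat
  have sum: "(CLBINT t=ereal (-real T)..ereal (real T). inversion_kernel a b t * edgeworth_char c d t) = I T + J T" for T :: nat
    unfolding split I_def J_def
  proof (rule interval_lebesgue_integral_add)
    show "interval_lebesgue_integrable lborel (ereal (- real T)) (ereal (real T))
        (\<lambda>t. inversion_kernel a b t * char std_normal_distribution t)"
      by (rule interval_integrable_bounded[OF _ norm_inversion_kernel_mult_le[OF assms N.cmod_char_le_1]]) measurable
    show "interval_lebesgue_integrable lborel (ereal (- real T)) (ereal (real T)) h"
      using integrable_mult_indicator[OF _ int_h]
      by (auto simp: interval_lebesgue_integrable_def set_integrable_def)
  qed
  have atom: "measure std_normal_distribution {x} = 0" for x
    by (simp add: measure_def emeasure_density nn_integral_null_set)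
  have "(\<lambda>T. 1 / (2 * pi) * I T) \<longlonglongrightarrow> of_real (measure std_normal_distribution {a<..b})"
    using N.Levy_Inversion[OF assms atom atom] unfolding I_def inversion_kernel_def by simp
  also have "measure std_normal_distribution {a<..b} = Phi b - Phi a"
    using assms N.cdf_diff_eq[of a b] by (cases "a = b") (auto simp: Phi_def)
  finally have L1: "(\<lambda>T. 1 / (2 * pi) * I T) \<longlonglongrightarrow> of_real (Phi b - Phi a)" .
  have L2: "(\<lambda>T. 1 / (2 * pi) * J T) \<longlonglongrightarrow> 1 / (2 * pi) * (CLBINT t. h t)"
    unfolding J_def using LBINT_symmetric_tendsto[OF int_h] by (intro tendsto_mult tendsto_const) simp
  have G: "gauss_moment 2 (-x) / s = of_real ((x\<^sup>2 - 1) * std_normal_density x)"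
            "gauss_moment 3 (-x) / s = of_real ((x ^ 3 - 3 * x) * std_normal_density x)"
            "gauss_moment 5 (-x) / s = of_real ((x ^ 5 - 10 * x ^ 3 + 15 * x) * std_normal_density x)" for x
    unfolding gauss_moment_values by (simp_all add: std_normal_density_def s_def)
  have cs: "1 / (2 * pi) * (s * X) = X / s" for X :: complex
    using s by (simp add: field_simps)
  have "(CLBINT t. h t) = s * (c * (gauss_moment 2 (-a) - gauss_moment 2 (-b))
     + d * (gauss_moment 3 (-a) - gauss_moment 3 (-b))
     + of_real (c\<^sup>2 / 2) * (gauss_moment 5 (-a) - gauss_moment 5 (-b)))"
    unfolding h_def gauss_moment_def m_def[symmetric]
    by (simp only: Bochner_Integration.integral_add Bochner_Integration.integral_diff
      Bochner_Integration.integrable_add Bochner_Integration.integrable_diff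
        integrable_mult_right integral_mult_right_zero int_m)
  also have "1 / (2 * pi) * \<dots> = (c * (gauss_moment 2 (-a) / s - gauss_moment 2 (-b) / s)
     + d * (gauss_moment 3 (-a) / s - gauss_moment 3 (-b) / s)
     + of_real (c\<^sup>2 / 2) * (gauss_moment 5 (-a) / s - gauss_moment 5 (-b) / s))"
    unfolding cs by (simp only: add_divide_distrib diff_divide_distrib times_divide_eq_right[symmetric])
  finally have "1 / (2 * pi) * (CLBINT t. h t) =
      of_real ((edgeworth_cdf c d b - Phi b) - (edgeworth_cdf c d a - Phi a))"
    unfolding G by (simp add: edgeworth_cdf_def algebra_simps)
  with tendsto_add[OF L1 L2] show ?thesis
    unfolding sum by (simp add: ring_distribs)
qed

section \<open>Smoothing\<close>

definition uniform_sym :: "real \<Rightarrow> real measure" where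
  "uniform_sym h = density lborel (\<lambda>x. ennreal (indicator {-h..h} x / (2 * h)))"

lemma sets_uniform_sym [measurable_cong, simp]: "sets (uniform_sym h) = sets borel"
  and space_uniform_sym [simp]: "space (uniform_sym h) = UNIV"
  by (simp_all add: uniform_sym_def)

lemma integral_uniform_sym:
  fixes f :: "real \<Rightarrow> 'a::{banach, second_countable_topology}"
  assumes "h > 0" and [measurable]: "f \<in> borel_measurable borel"
  shows "(\<integral>x. f x \<partial>uniform_sym h) = (LBINT x:{-h..h}. f x) /\<^sub>R (2 * h)"
proof -
  have "(\<integral>x. f x \<partial>uniform_sym h) = (LBINT x. (indicator {-h..h} x / (2 * h)) *\<^sub>R f x)"
    unfolding uniform_sym_def using assms(1) by (subst integral_density) auto
  also have "\<dots> = (LBINT x. inverse (2 * h) *\<^sub>R (indicator {-h..h} x *\<^sub>R f x))"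
    by (simp only: scaleR_scaleR divide_inverse mult.commute[of "inverse (2 * h)"])
  finally show ?thesis by (simp only: set_lebesgue_integral_def integral_scaleR_right)
qed

lemma real_distribution_uniform_sym:
  assumes "h > 0"
  shows "real_distribution (uniform_sym h)"
proof -
  have "emeasure (uniform_sym h) UNIV = (\<integral>\<^sup>+x. ennreal (1 / (2 * h)) * indicator {-h..h} x \<partial>lborel)"
    unfolding uniform_sym_def using assms
    by (subst emeasure_density) (auto intro!: nn_integral_cong simp: indicator_def)
  also have "\<dots> = ennreal (1 / (2 * h)) * ennreal (2 * h)"
    using assms by (subst nn_integral_cmult_indicator) auto
  also have "\<dots> = 1"
    using assms by (simp flip: ennreal_mult)
  finally have "prob_space (uniform_sym h)" by (intro prob_spaceI) simp
  then show ?thesis by (simp add: real_distribution_def real_distribution_axioms_def)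
qed

lemma AE_uniform_sym: "h > 0 \<Longrightarrow> AE x in uniform_sym h. \<bar>x\<bar> \<le> h"
  unfolding uniform_sym_def by (subst AE_density) (auto simp: indicator_def intro!: AE_I2)

lemma emeasure_uniform_sym_singleton: "emeasure (uniform_sym h) {x} = 0"
  unfolding uniform_sym_def by (subst emeasure_density) (auto intro!: nn_integral_null_set)

text \<open>From |exp(iy) - 1| <= |y| and |x| <= h almost surely. It measures the price of smoothing
  in the central range of t.\<close>

lemma norm_char_uniform_sym_minus_1:
  assumes "h > 0"
  shows "cmod (char (uniform_sym h) t - 1) \<le> h * \<bar>t\<bar>"
proof -
  interpret U: real_distribution "uniform_sym h" by (rule real_distribution_uniform_sym) fact
  have int: "integrable (uniform_sym h) (\<lambda>x. iexp (t * x))"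
    by (intro U.integrable_iexp) auto
  have P: "U.prob UNIV = 1" using U.prob_space by simp
  have "char (uniform_sym h) t - 1 = (CLINT x|uniform_sym h. iexp (t * x) - 1)"
    unfolding char_def using int P by (subst Bochner_Integration.integral_diff) auto
  also have "cmod \<dots> \<le> (\<integral>x. cmod (iexp (t * x) - 1) \<partial>uniform_sym h)"
    by (rule integral_norm_bound)
  also have "\<dots> \<le> (\<integral>x. h * \<bar>t\<bar> \<partial>uniform_sym h)"
  proof (rule integral_mono_AE)
    show "integrable (uniform_sym h) (\<lambda>x. cmod (iexp (t * x) - 1))"
      using int by (intro integrable_norm Bochner_Integration.integrable_diff) auto
    show "AE x in uniform_sym h. cmod (iexp (t * x) - 1) \<le> h * \<bar>t\<bar>"
      using AE_uniform_sym[OF assms]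
    proof eventually_elim
      case (elim x)
      have "cmod (iexp (t * x) - 1) \<le> \<bar>t * x\<bar>"
        using iexp_approx1[of "t * x" 0] by simp
      also have "\<dots> \<le> h * \<bar>t\<bar>" using mult_left_mono[OF elim, of "\<bar>t\<bar>"] by (simp add: abs_mult mult.commute)
      finally show ?case .
    qed
  qed auto
  also have "\<dots> = h * \<bar>t\<bar>" using P by simp
  finally show ?thesis .
qed

text \<open>The transform is sin(ht)/(ht), obtained here by integrating the exponential. This decay
  makes the tail of the inversion integral converge absolutely.\<close>

lemma norm_char_uniform_sym_le:
  assumes "h > 0" "t \<noteq> 0"
  shows "cmod (char (uniform_sym h) t) \<le> 1 / (h * \<bar>t\<bar>)"
proof -
  have "(CLBINT x:{-h..h}. iexp (t * x)) = (CLBINT x=-h..h. iexp (t * x))"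
    using assms by (subst interval_integral_Icc) auto
  also have "\<dots> = iexp (t * h) / (\<i> * t) - iexp (t * (-h)) / (\<i> * t)"
  proof (rule interval_integral_FTC_finite)
    show "continuous_on {min (-h) h..max (-h) h} (\<lambda>x. iexp (t * x))"
      by (intro continuous_intros)
    fix x
    have "((\<lambda>z. exp (\<i> * (t * z)) / (\<i> * t)) has_field_derivative iexp (t * x)) (at (of_real x))"
      using assms(2) by (auto intro!: derivative_eq_intros simp: mult_ac)
    then have "((\<lambda>x. iexp (t * x) / (\<i> * t)) has_vector_derivative iexp (t * x)) (at x)"
      by (auto dest: has_vector_derivative_real_field)
    then show "((\<lambda>x. iexp (t * x) / (\<i> * t)) has_vector_derivative iexp (t * x)) (at x within {min (-h) h..max (-h) h})"
      by (rule has_vector_derivative_at_within)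
  qed
  also have "cmod \<dots> \<le> cmod (iexp (t * h) / (\<i> * t)) + cmod (iexp (t * (-h)) / (\<i> * t))"
    by (rule norm_triangle_ineq4)
  also have "\<dots> = 2 / \<bar>t\<bar>" by (simp add: norm_divide norm_mult)
  finally have "cmod (CLBINT x:{-h..h}. iexp (t * x)) \<le> 2 / \<bar>t\<bar>" .
  moreover have "char (uniform_sym h) t = (CLBINT x:{-h..h}. iexp (t * x)) /\<^sub>R (2 * h)"
    unfolding char_def using assms by (intro integral_uniform_sym) auto
  ultimately show ?thesis
    using assms by (simp add: field_simps)
qed

lemma char_convolution:
  assumes "real_distribution M" "real_distribution N"
  shows "char (M \<star> N) t = char M t * char N t"
proof -
  interpret M: real_distribution M by fact
  interpret N: real_distribution N by fact
  interpret P: pair_prob_space M N ..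
  have int: "integrable (M \<Otimes>\<^sub>M N) (\<lambda>p. iexp (t * (fst p + snd p)))"
    by (intro P.integrable_iexp) auto
  have "char (M \<star> N) t = (CLINT p|M \<Otimes>\<^sub>M N. iexp (t * (fst p + snd p)))"
    unfolding char_def convolution_def
    by (subst integral_distr) (auto simp: case_prod_beta)
  also have "\<dots> = (CLINT x|M. CLINT y|N. iexp (t * (x + y)))"
    using P.integral_fst'[of "\<lambda>p. iexp (t * (fst p + snd p))"] int by simp
  also have "\<dots> = (CLINT x|M. CLINT y|N. iexp (t * x) * iexp (t * y))"
    by (simp add: ring_distribs exp_add)
  also have "\<dots> = char M t * char N t"
    unfolding char_def by simp
  finally show ?thesis .
qed

lemma real_distribution_convolution:
  assumes "real_distribution M" "real_distribution N"
  shows "real_distribution (M \<star> N)"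
proof -
  interpret M: real_distribution M by fact
  interpret N: real_distribution N by fact
  interpret P: pair_prob_space M N ..
  show ?thesis unfolding convolution_def by (rule P.real_distribution_distr) measurable
qed

text \<open>For independent X and U with |U| <= h almost surely, X <= x - h implies X + U <= x,
  which implies X <= x + h, up to a null set.\<close>

lemma cdf_convolution_uniform_sym:
  assumes "real_distribution M" "h > 0"
  shows "cdf M (x - h) \<le> cdf (M \<star> uniform_sym h) x" and "cdf (M \<star> uniform_sym h) x \<le> cdf M (x + h)"
proof -
  interpret M: real_distribution M by fact
  interpret U: real_distribution "uniform_sym h" by (rule real_distribution_uniform_sym) fact
  interpret P: pair_prob_space M "uniform_sym h" ..
  let ?P = "M \<Otimes>\<^sub>M uniform_sym h"
  have conv: "cdf (M \<star> uniform_sym h) x = measure ?P {p. fst p + snd p \<le> x}"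
    unfolding cdf_def convolution_def
    by (subst measure_distr) (auto simp: space_pair_measure case_prod_beta intro!: arg_cong2[where f=measure])
  have proj: "cdf M y = measure ?P {p. fst p \<le> y}" for y
  proof -
    have "{p. fst p \<le> y} = {..y} \<times> (UNIV :: real set)" by auto
    moreover have "measure ?P ({..y} \<times> UNIV) = measure M {..y} * measure (uniform_sym h) UNIV"
      by (simp add: measure_def U.emeasure_pair_measure_Times enn2real_mult)
    moreover have "U.prob UNIV = 1" using U.prob_space by simp
    ultimately show ?thesis by (simp add: cdf_def)
  qed
  have AE: "AE p in ?P. \<bar>snd p\<bar> \<le> h"
  proof (rule P.AE_pair_measure)
    show "{p \<in> space ?P. \<bar>snd p\<bar> \<le> h} \<in> sets ?P" by measurable
  qed (auto intro: AE_uniform_sym assms)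
  have m [measurable]: "{p. fst p + snd p \<le> y} \<in> sets ?P" "{p. fst p \<le> y} \<in> sets ?P" for y
  proof -
    have "{p \<in> space ?P. fst p + snd p \<le> y} \<in> sets ?P" "{p \<in> space ?P. fst p \<le> y} \<in> sets ?P" by measurable
    then show "{p. fst p + snd p \<le> y} \<in> sets ?P" "{p. fst p \<le> y} \<in> sets ?P" by (simp_all add: space_pair_measure)
  qed
  show "cdf M (x - h) \<le> cdf (M \<star> uniform_sym h) x" unfolding conv proj
    by (rule P.finite_measure_mono_AE) (use AE m in \<open>auto elim!: eventually_mono\<close>)
  show "cdf (M \<star> uniform_sym h) x \<le> cdf M (x + h)" unfolding conv proj
    by (rule P.finite_measure_mono_AE) (use AE m in \<open>auto elim!: eventually_mono\<close>)
qed

text \<open>Every translate of a point is null for the uniform law. Levy's formula thus holds for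
  the smoothed law at all endpoints, whatever atoms \<open>M\<close> has.\<close>

lemma measure_convolution_uniform_sym_singleton:
  assumes "real_distribution M" "h > 0"
  shows "measure (M \<star> uniform_sym h) {a} = 0"
proof -
  interpret M: real_distribution M by fact
  interpret U: real_distribution "uniform_sym h" by (rule real_distribution_uniform_sym) fact
  have "emeasure (M \<star> uniform_sym h) {a} = (\<integral>\<^sup>+x. emeasure (uniform_sym h) {y. y + x \<in> {a}} \<partial>M)"
    by (rule convolution_emeasure) (auto intro: M.finite_measure_axioms U.finite_measure_axioms)
  moreover have "{y. y + x \<in> {a}} = {a - x}" for x by auto
  ultimately have "emeasure (M \<star> uniform_sym h) {a} = 0"
    by (simp add: emeasure_uniform_sym_singleton)
  then show ?thesis by (simp add: measure_def)
qed

section \<open>Bounds on distribution functions through inversion integrals\<close>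

lemma interval_integral_inverse_1_plus_square_le:
  assumes "0 \<le> T"
  shows "(LBINT t=ereal (-T)..ereal T. 1 / (1 + t\<^sup>2)) \<le> pi"
proof -
  have "(LBINT t=ereal (-T)..ereal T. 1 / (1 + t\<^sup>2)) = arctan T - arctan (-T)"
  proof (rule interval_integral_FTC_finite)
    show "continuous_on {min (-T) T..max (-T) T} (\<lambda>t. 1 / (1 + t\<^sup>2))"
      by (intro continuous_intros) (auto simp: add_nonneg_eq_0_iff)
    fix x
    show "(arctan has_vector_derivative 1 / (1 + x\<^sup>2)) (at x within {min (-T) T..max (-T) T})"
      using DERIV_arctan[of x] by (auto intro: has_vector_derivative_at_within
          simp: has_real_derivative_iff_has_vector_derivative inverse_eq_divide)
  qed
  also have "\<dots> \<le> pi" using arctan_ubound[of T] by (simp add: arctan_minus)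
  finally show ?thesis .
qed

text \<open>The majorant integrates to at most 2 E pi for every \<open>T\<close>, which the
  prefactor 1/(2 pi) turns into exactly \<open>E\<close>.\<close>

lemma norm_inversion_integral_le:
  fixes f :: "real \<Rightarrow> complex"
  assumes int: "interval_lebesgue_integrable lborel (ereal (-real T)) (ereal (real T)) f"
    and bd: "\<And>t. cmod (f t) \<le> 2 * E / (1 + t\<^sup>2)" and E: "0 \<le> E"
  shows "cmod (1 / (2 * pi) * (CLBINT t=ereal (-real T)..ereal (real T). f t)) \<le> E"
proof -
  let ?k = "\<lambda>t::real. 2 * E * (1 / (1 + t\<^sup>2))"
  let ?I = "CLBINT t=ereal (-real T)..ereal (real T). f t"
  have cont: "continuous_on S ?k" for S
    by (intro continuous_intros) (auto simp: add_nonneg_eq_0_iff)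
  have "cmod ?I \<le> (LBINT t. norm (indicator {-real T<..<real T} t *\<^sub>R f t))"
    unfolding interval_lebesgue_integral_def set_lebesgue_integral_def
    using integral_norm_bound[of lborel "\<lambda>t. indicator {-real T<..<real T} t *\<^sub>R f t"] by simp
  also have "\<dots> \<le> (LBINT t. indicator {-real T<..<real T} t *\<^sub>R ?k t)"
  proof (rule integral_mono)
    show "integrable lborel (\<lambda>t. norm (indicator {-real T<..<real T} t *\<^sub>R f t))"
      using int by (intro integrable_norm) (simp add: interval_lebesgue_integrable_def set_integrable_def)
    have "set_integrable lborel {-real T<..<real T} ?k"
      by (rule set_integrable_subset[OF borel_integrable_atLeastAtMost'[OF cont[of "{-real T..real T}"]]]) auto
    then show "integrable lborel (\<lambda>t. indicator {-real T<..<real T} t *\<^sub>R ?k t)"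
      by (simp add: set_integrable_def)
    show "norm (indicator {-real T<..<real T} t *\<^sub>R f t) \<le> indicator {-real T<..<real T} t *\<^sub>R ?k t" for t
      using bd[of t] by (simp add: indicator_def)
  qed
  also have "\<dots> = (LBINT t=ereal (-real T)..ereal (real T). ?k t)"
    by (simp add: interval_lebesgue_integral_def set_lebesgue_integral_def)
  also have "\<dots> = 2 * E * (LBINT t=ereal (-real T)..ereal (real T). 1 / (1 + t\<^sup>2))"
    by (rule interval_lebesgue_integral_mult_right)
  also have "\<dots> \<le> 2 * E * pi"
    using E by (intro mult_left_mono interval_integral_inverse_1_plus_square_le) auto
  finally have "cmod ?I / (2 * pi) \<le> E" by (simp add: field_simps)
  moreover have "cmod (1 / (2 * pi) * ?I) = cmod ?I / (2 * pi)"
    by (simp add: norm_mult norm_divide)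
  ultimately show ?thesis by simp
qed

theorem smoothing_inequality:
  fixes G :: "real \<Rightarrow> real" and g :: "real \<Rightarrow> complex"
  assumes M: "real_distribution M" and h: "h > 0" and E: "0 \<le> E"
    and inv: "\<And>a b. a \<le> b \<Longrightarrow>
       (\<lambda>T::nat. 1 / (2 * pi) * (CLBINT t=ereal (-real T)..ereal (real T). inversion_kernel a b t * g t)) \<longlonglongrightarrow> of_real (G b - G a)"
    and [measurable]: "g \<in> borel_measurable borel" and g_bound: "\<And>t. cmod (g t) \<le> B"
    and G_bot: "(G \<longlongrightarrow> 0) at_bot"
    and G_lip: "\<And>x y. \<bar>G x - G y\<bar> \<le> L * \<bar>x - y\<bar>"
    and close: "\<And>t. t \<noteq> 0 \<Longrightarrow> cmod (char M t * char (uniform_sym h) t - g t) \<le> E * \<bar>t\<bar> / (1 + t\<^sup>2)"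
  shows "\<bar>cdf M x - G x\<bar> \<le> E + L * h"
proof -
  interpret M: real_distribution M by fact
  define N where "N = (M \<star> uniform_sym h)"
  interpret N: real_distribution N
    unfolding N_def by (rule real_distribution_convolution[OF M real_distribution_uniform_sym[OF h]])
  have chN: "char N t = char M t * char (uniform_sym h) t" for t
    unfolding N_def by (rule char_convolution[OF M real_distribution_uniform_sym[OF h]])
  define D where "D y = cdf N y - G y" for y
  have incr: "\<bar>D b - D a\<bar> \<le> E" if ab: "a \<le> b" for a b
  proof -
    define I where "I T = (CLBINT t=ereal (-real T)..ereal (real T). inversion_kernel a b t * char N t)" for T :: nat
    define J where "J T = (CLBINT t=ereal (-real T)..ereal (real T). inversion_kernel a b t * g t)" for T :: nat
    have int: "interval_lebesgue_integrable lborel (ereal u) (ereal v) (\<lambda>t. inversion_kernel a b t * char N t)"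
              "interval_lebesgue_integrable lborel (ereal u) (ereal v) (\<lambda>t. inversion_kernel a b t * g t)" for u v
      by (rule interval_integrable_bounded[OF _ norm_inversion_kernel_mult_le[OF ab N.cmod_char_le_1]], measurable)
         (rule interval_integrable_bounded[OF _ norm_inversion_kernel_mult_le[OF ab g_bound]], measurable)
    have "(\<lambda>T. 1 / (2 * pi) * I T) \<longlonglongrightarrow> of_real (measure N {a<..b})"
      using N.Levy_Inversion[OF ab] measure_convolution_uniform_sym_singleton[OF M h]
      unfolding I_def inversion_kernel_def N_def[symmetric] by simp
    also have "measure N {a<..b} = cdf N b - cdf N a"
      using ab N.cdf_diff_eq[of a b] by (cases "a = b") auto
    finally have L1: "(\<lambda>T. 1 / (2 * pi) * I T) \<longlonglongrightarrow> of_real (cdf N b - cdf N a)" .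
    have L2: "(\<lambda>T. 1 / (2 * pi) * J T) \<longlonglongrightarrow> of_real (G b - G a)"
      using inv[OF ab] unfolding J_def by simp
    have L: "(\<lambda>T. 1 / (2 * pi) * (I T - J T)) \<longlonglongrightarrow> of_real (D b - D a)"
      using tendsto_diff[OF L1 L2] unfolding D_def by (simp add: diff_divide_distrib algebra_simps)
    have bd: "cmod (1 / (2 * pi) * (I T - J T)) \<le> E" for T :: nat
    proof -
      let ?d = "\<lambda>t. inversion_kernel a b t * char N t - inversion_kernel a b t * g t"
      have "I T - J T = (CLBINT t=ereal (-real T)..ereal (real T). ?d t)"
        unfolding I_def J_def by (rule interval_lebesgue_integral_diff(2)[OF int, symmetric])
      moreover have "cmod (1 / (2 * pi) * (CLBINT t=ereal (-real T)..ereal (real T). ?d t)) \<le> E"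
      proof (rule norm_inversion_integral_le)
        show "cmod (?d t) \<le> 2 * E / (1 + t\<^sup>2)" for t
        \<comment> \<open>\<open>close\<close> says nothing at 0, but there the kernel has value
          0.\<close>
        proof (cases "t = 0")
          case False
          have "cmod (?d t) = cmod (inversion_kernel a b t) * cmod (char N t - g t)"
            by (simp add: right_diff_distrib[symmetric] norm_mult)
          also have "\<dots> \<le> 2 / \<bar>t\<bar> * (E * \<bar>t\<bar> / (1 + t\<^sup>2))"
            using close[OF False] unfolding chN by (intro mult_mono norm_inversion_kernel_le) auto
          also have "\<dots> = 2 * E / (1 + t\<^sup>2)" using False by simp
          finally show ?thesis .
        qed (use E in \<open>simp add: inversion_kernel_def\<close>)
      qed (use E in \<open>auto intro: interval_lebesgue_integral_diff(1)[OF int]\<close>)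
      ultimately show ?thesis by simp
    qed
    have "(\<lambda>T. cmod (1 / (2 * pi) * (I T - J T))) \<longlonglongrightarrow> cmod (of_real (D b - D a))"
      by (rule tendsto_norm[OF L])
    then have "cmod (of_real (D b - D a)) \<le> E"
      by (rule LIMSEQ_le_const2) (use bd in blast)
    then show ?thesis by (simp only: norm_of_real)
  qed
  have D: "\<bar>D y\<bar> \<le> E" for y
  proof -
    \<comment> \<open>Both functions vanish at minus infinity, so letting the left endpoint go there
      turns the bound on increments into a bound on \<open>D\<close> itself.\<close>
    have "(D \<longlongrightarrow> 0 - 0) at_bot"
      unfolding D_def by (intro tendsto_diff N.cdf_lim_at_bot G_bot)
    then have "((\<lambda>a. \<bar>D y - D a\<bar>) \<longlongrightarrow> \<bar>D y - 0\<bar>) at_bot"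
      by (intro tendsto_intros) simp
    then have "\<bar>D y - 0\<bar> \<le> E"
      by (rule tendsto_upperbound) (auto simp: eventually_at_bot_linorder intro!: exI[of _ y] incr)
    then show ?thesis by simp
  qed
  have "cdf M x \<le> cdf N (x + h)"
    using cdf_convolution_uniform_sym(1)[OF M h, of "x + h"] by (simp add: N_def)
  moreover have "cdf N (x - h) \<le> cdf M x"
    using cdf_convolution_uniform_sym(2)[OF M h, of "x - h"] by (simp add: N_def)
  ultimately show ?thesis
    using D[of "x + h"] D[of "x - h"] G_lip[of x "x + h"] G_lip[of x "x - h"] h unfolding D_def by simp
qed

section \<open>The Edgeworth expansion\<close>

text \<open>Read off from the inversion formula instead of a derivative: the kernel is at most
  \<open>b - a\<close> and the transform at most C/(1 + t^2). The constant is uniform in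
  \<open>c\<close> and \<open>d\<close>, hence in n.\<close>

lemma edgeworth_cdf_lipschitz:
  obtains L where "0 \<le> L"
    "\<And>c d x y. \<bar>c\<bar> \<le> B \<Longrightarrow> \<bar>d\<bar> \<le> B \<Longrightarrow> \<bar>edgeworth_cdf c d x - edgeworth_cdf c d y\<bar> \<le> L * \<bar>x - y\<bar>"
proof -
  obtain C where C: "0 \<le> C"
    "\<And>c d t. \<bar>c\<bar> \<le> B \<Longrightarrow> \<bar>d\<bar> \<le> B \<Longrightarrow> cmod (edgeworth_char c d t) * (1 + \<bar>t\<bar> ^ 2) \<le> C"
    by (rule edgeworth_char_gauss_le[of B 2]) (rule that; assumption)
  have main: "\<bar>edgeworth_cdf c d b - edgeworth_cdf c d a\<bar> \<le> C / 2 * (b - a)"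
    if cd: "\<bar>c\<bar> \<le> B" "\<bar>d\<bar> \<le> B" and ab: "a \<le> b" for c d a b
  proof -
    obtain B' where B': "\<And>t. cmod (edgeworth_char c d t) \<le> B'"
      by (rule edgeworth_char_bounded[of c d]) (rule that; assumption)
    have "cmod (of_real (edgeworth_cdf c d b - edgeworth_cdf c d a)) \<le> C / 2 * (b - a)"
    proof (rule LIMSEQ_le_const2[OF tendsto_norm[OF edgeworth_inversion[OF ab]]], intro exI allI impI)
      fix T :: nat
      show "cmod (1 / (2 * pi) * (CLBINT t=ereal (-real T)..ereal (real T). inversion_kernel a b t * edgeworth_char c d t))
          \<le> C / 2 * (b - a)"
      proof (rule norm_inversion_integral_le)
        show "interval_lebesgue_integrable lborel (ereal (- real T)) (ereal (real T))
            (\<lambda>t. inversion_kernel a b t * edgeworth_char c d t)"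
          by (rule interval_integrable_bounded[OF _ norm_inversion_kernel_mult_le[OF ab B']]) measurable
        fix t
        have "cmod (edgeworth_char c d t) \<le> C / (1 + t\<^sup>2)"
          using C(2)[OF cd, of t] by (simp add: field_simps add_pos_nonneg)
        then have "cmod (inversion_kernel a b t * edgeworth_char c d t) \<le> (b - a) * (C / (1 + t\<^sup>2))"
          unfolding norm_mult using ab norm_inversion_kernel_le_diff[OF ab, of t] by (intro mult_mono) auto
        then show "cmod (inversion_kernel a b t * edgeworth_char c d t) \<le> 2 * (C / 2 * (b - a)) / (1 + t\<^sup>2)"
          by (simp add: mult.commute)
      qed (use C ab in auto)
    qed
    then show ?thesis by (simp only: norm_of_real)
  qed
  show ?thesis
  proof (rule that[of "C / 2"])
    fix c d x y :: real assume cd: "\<bar>c\<bar> \<le> B" "\<bar>d\<bar> \<le> B"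
    show "\<bar>edgeworth_cdf c d x - edgeworth_cdf c d y\<bar> \<le> C / 2 * \<bar>x - y\<bar>"
      using main[OF cd, of x y] main[OF cd, of y x] by (cases "x \<le> y") (auto simp: abs_minus_commute)
  qed (use C in auto)
qed

lemma edgeworth_cdf_at_bot: "(edgeworth_cdf c d \<longlongrightarrow> 0) at_bot"
proof -
  interpret N: real_distribution std_normal_distribution by (rule real_dist_normal_dist)
  have P: "(Phi \<longlongrightarrow> 0) at_bot"
    unfolding Phi_def[abs_def] by (rule N.cdf_lim_at_bot)
  have pw: "((\<lambda>x. x ^ k * std_normal_density x) \<longlongrightarrow> 0) at_bot" for k
    by (rule tendsto_norm_zero_cancel)
       (use std_normal_density_abs_power_tendsto_0[OF at_bot_le_at_infinity, of k] in \<open>simp add: abs_mult power_abs\<close>)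
  have "((\<lambda>x. Phi x - (c * (x ^ 2 * std_normal_density x - x ^ 0 * std_normal_density x)
      + d * (x ^ 3 * std_normal_density x - 3 * (x ^ 1 * std_normal_density x))
      + c\<^sup>2 / 2 * (x ^ 5 * std_normal_density x - 10 * (x ^ 3 * std_normal_density x) + 15 * (x ^ 1 * std_normal_density x))))
     \<longlongrightarrow> 0 - (c * (0 - 0) + d * (0 - 3 * 0) + c\<^sup>2 / 2 * (0 - 10 * 0 + 15 * 0))) at_bot"
    by (intro tendsto_diff tendsto_add tendsto_mult tendsto_const P pw)
  then show ?thesis
    by (simp add: edgeworth_cdf_def[abs_def] algebra_simps)
qed

text \<open>Brings the central error to the shape that \<open>smoothing_inequality\<close> expects.
  One factor |t| is set aside for the kernel; the rest is bounded after multiplication by 1 +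
  t^2.\<close>

lemma abs_power_sum_gauss_le:
  obtains A where "0 \<le> A"
    "\<And>t::real. (\<bar>t\<bar> ^ 5 + \<bar>t\<bar> ^ 7 + \<bar>t\<bar> ^ 9) * exp (- t\<^sup>2 / 4) \<le> A * (\<bar>t\<bar> / (1 + t\<^sup>2))"
proof -
  have "\<exists>C. \<forall>t::real. \<bar>t\<bar> ^ j * exp (- t\<^sup>2 / 4) \<le> C" for j
    by (meson abs_power_gauss_bounded)
  then obtain A where A: "\<And>j t. \<bar>t::real\<bar> ^ j * exp (- t\<^sup>2 / 4) \<le> A j" by metis
  define D where "D = (A 4 + A 6) + (A 6 + A 8) + (A 8 + A 10)"
  show ?thesis
  proof (rule that[of "\<bar>D\<bar>"])
    fix t :: real
    define e where "e = exp (- t\<^sup>2 / 4)"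
    have "(\<bar>t\<bar> ^ 4 + \<bar>t\<bar> ^ 6 + \<bar>t\<bar> ^ 8) * e * (1 + \<bar>t\<bar> ^ 2)
        = (\<bar>t\<bar> ^ 4 * e + \<bar>t\<bar> ^ 6 * e) + (\<bar>t\<bar> ^ 6 * e + \<bar>t\<bar> ^ 8 * e) + (\<bar>t\<bar> ^ 8 * e + \<bar>t\<bar> ^ 10 * e)"
      by (simp add: algebra_simps flip: power_add)
    also have "\<dots> \<le> D" unfolding e_def D_def by (intro add_mono A)
    also have "\<dots> \<le> \<bar>D\<bar>" by simp
    finally have "(\<bar>t\<bar> ^ 4 + \<bar>t\<bar> ^ 6 + \<bar>t\<bar> ^ 8) * e \<le> \<bar>D\<bar> / (1 + t\<^sup>2)"
      by (simp add: pos_le_divide_eq add_pos_nonneg)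
    then have "\<bar>t\<bar> * ((\<bar>t\<bar> ^ 4 + \<bar>t\<bar> ^ 6 + \<bar>t\<bar> ^ 8) * e) \<le> \<bar>t\<bar> * (\<bar>D\<bar> / (1 + t\<^sup>2))"
      by (rule mult_left_mono) simp
    also have "\<bar>t\<bar> * ((\<bar>t\<bar> ^ 4 + \<bar>t\<bar> ^ 6 + \<bar>t\<bar> ^ 8) * e) = (\<bar>t\<bar> ^ 5 + \<bar>t\<bar> ^ 7 + \<bar>t\<bar> ^ 9) * e"
      by (simp add: algebra_simps power_numeral_reduce)
    also have "\<bar>t\<bar> * (\<bar>D\<bar> / (1 + t\<^sup>2)) = \<bar>D\<bar> * (\<bar>t\<bar> / (1 + t\<^sup>2))" by simp
    finally show "(\<bar>t\<bar> ^ 5 + \<bar>t\<bar> ^ 7 + \<bar>t\<bar> ^ 9) * exp (- t\<^sup>2 / 4) \<le> \<bar>D\<bar> * (\<bar>t\<bar> / (1 + t\<^sup>2))"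
      by (simp only: e_def)
  qed simp
qed

text \<open>Only the characteristic functions of the laws \<open>P n\<close> enter, so the random
  variables themselves do not appear. The bound is uniform on the whole line; the restriction to |x|
  <= \<kappa>_n arises only in the passage to the polynomial.\<close>

theorem (in real_distribution) edgeworth_expansion:
  fixes P :: "nat \<Rightarrow> real measure"
  assumes mom: "\<And>k::nat. integrable M (\<lambda>x. x ^ k)"
    and mean: "expectation (\<lambda>x. x) = 0" and var: "expectation (\<lambda>x. x\<^sup>2) = 1"
    and lim: "(char M \<longlongrightarrow> 0) at_infinity"
    and P: "\<And>n. 0 < n \<Longrightarrow> real_distribution (P n)"
    and chP: "\<And>n t. 0 < n \<Longrightarrow> char (P n) t = char M (t / sqrt n) ^ n"
    and "\<epsilon> > 0"
  defines "c \<equiv> \<lambda>n. expectation (\<lambda>x. x ^ 3) / (6 * sqrt (real n))"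
    and "d \<equiv> \<lambda>n. (expectation (\<lambda>x. x ^ 4) - 3) / (24 * real n)"
  shows "\<forall>\<^sub>F n in sequentially. \<forall>x. \<bar>cdf (P n) x - edgeworth_cdf (c n) (d n) x\<bar> \<le> \<epsilon> / n"
proof -
  define B where "B = max \<bar>expectation (\<lambda>x. x ^ 3)\<bar> \<bar>expectation (\<lambda>x. x ^ 4) - 3\<bar>"
  have cd: "\<bar>c n\<bar> \<le> B" "\<bar>d n\<bar> \<le> B" if "0 < n" for n
  proof -
    have "1 \<le> sqrt n" using that by simp
    then have s: "1 \<le> \<bar>6 * sqrt n\<bar>" "1 \<le> \<bar>24 * real n\<bar>" using that by linarith+
    have "\<bar>c n\<bar> \<le> \<bar>expectation (\<lambda>x. x ^ 3)\<bar> / 1"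
      unfolding c_def abs_divide using s by (intro divide_left_mono) auto
    moreover have "\<bar>d n\<bar> \<le> \<bar>expectation (\<lambda>x. x ^ 4) - 3\<bar> / 1"
      unfolding d_def abs_divide using s by (intro divide_left_mono) auto
    ultimately show "\<bar>c n\<bar> \<le> B" "\<bar>d n\<bar> \<le> B" by (auto simp: B_def)
  qed
  obtain K \<delta> where \<delta>: "0 < \<delta>" and K: "0 \<le> K" and center:
    "\<And>n t. 0 < n \<Longrightarrow> \<bar>t\<bar> \<le> \<delta> * sqrt (real n) \<Longrightarrow>
       cmod (char M (t / sqrt n) ^ n - edgeworth_char (expectation (\<lambda>x. x ^ 3) / (6 * sqrt (real n)))
           ((expectation (\<lambda>x. x ^ 4) - 3) / (24 * real n)) t)
         \<le> K / (real n * sqrt n) * ((\<bar>t\<bar> ^ 5 + \<bar>t\<bar> ^ 7 + \<bar>t\<bar> ^ 9) * exp (- t\<^sup>2 / 4))"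
    by (rule char_power_edgeworth[OF mom mean var]) (rule that; assumption)
  have cd_eq: "expectation (\<lambda>x. x ^ 3) / (6 * sqrt (real n)) = c n"
    "(expectation (\<lambda>x. x ^ 4) - 3) / (24 * real n) = d n" for n
    by (simp_all add: c_def d_def)
  note center = center[unfolded cd_eq]
  obtain q where q: "0 \<le> q" "q < 1" "\<And>u. \<delta> \<le> \<bar>u\<bar> \<Longrightarrow> cmod (char M u) \<le> q"
    by (rule cmod_char_bounded_away[OF lim \<delta>]) (rule that; assumption)
  obtain A where A: "0 \<le> A"
    "\<And>t::real. (\<bar>t\<bar> ^ 5 + \<bar>t\<bar> ^ 7 + \<bar>t\<bar> ^ 9) * exp (- t\<^sup>2 / 4) \<le> A * (\<bar>t\<bar> / (1 + t\<^sup>2))"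
    by (rule abs_power_sum_gauss_le) (rule that; assumption)
  obtain C2 where C2: "0 \<le> C2"
    "\<And>c d t. \<bar>c\<bar> \<le> B \<Longrightarrow> \<bar>d\<bar> \<le> B \<Longrightarrow> cmod (edgeworth_char c d t) * (1 + \<bar>t\<bar> ^ 2) \<le> C2"
    by (rule edgeworth_char_gauss_le[of B 2]) (rule that; assumption)
  obtain C5 where C5: "0 \<le> C5"
    "\<And>c d t. \<bar>c\<bar> \<le> B \<Longrightarrow> \<bar>d\<bar> \<le> B \<Longrightarrow> cmod (edgeworth_char c d t) * (1 + \<bar>t\<bar> ^ 5) \<le> C5"
    by (rule edgeworth_char_gauss_le[of B 5]) (rule that; assumption)
  obtain L where L: "0 \<le> L"
    "\<And>c d x y. \<bar>c\<bar> \<le> B \<Longrightarrow> \<bar>d\<bar> \<le> B \<Longrightarrow> \<bar>edgeworth_cdf c d x - edgeworth_cdf c d y\<bar> \<le> L * \<bar>x - y\<bar>"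
    by (rule edgeworth_cdf_lipschitz[of B]) (rule that; assumption)
  \<comment> \<open>The two errors of exact order 1/n add up to
    \<open>(C2 + L) * \<eta> / n\<close>; this choice keeps them below
    \<open>\<epsilon> / (2 * n)\<close>. The summand 1 keeps the denominator positive.\<close>
  define \<eta> where "\<eta> = \<epsilon> / (2 * (C2 + L + 1))"
  have \<eta>: "0 < \<eta>" using \<open>\<epsilon> > 0\<close> C2 L by (simp add: \<eta>_def)
  \<comment> \<open>In order: the central expansion error; smoothing in the central range; the
    smoothed characteristic function in the tail, where 1/h = n/\<eta>; and the tail of the
    Edgeworth transform. The factors 2 come from \<open>r_ge\<close>.\<close>
  define E where "E n = K * A / (real n * sqrt n) + C2 * (\<eta> / n) + 2 * q ^ n / (\<eta> / n) + 2 * C5 / (\<delta> ^ 4 * real n ^ 2)" for n :: nat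
  have E_nonneg: "0 \<le> E n" for n
    unfolding E_def using K A C2 C5 q \<eta> \<delta> by (intro add_nonneg_nonneg) auto
  have bound: "\<bar>cdf (P n) x - edgeworth_cdf (c n) (d n) x\<bar> \<le> E n + L * (\<eta> / n)"
    if n: "0 < n" and n_large: "1 \<le> \<delta> * sqrt n" for n x
  proof (rule smoothing_inequality)
    show "real_distribution (P n)" by (rule P[OF n])
    show h: "0 < \<eta> / n" using \<eta> n by simp
    show "(\<lambda>T::nat. 1 / (2 * pi) * (CLBINT t=ereal (-real T)..ereal (real T). inversion_kernel a b t * edgeworth_char (c n) (d n) t))
      \<longlonglongrightarrow> of_real (edgeworth_cdf (c n) (d n) b - edgeworth_cdf (c n) (d n) a)" if "a \<le> b" for a b
      by (rule edgeworth_inversion[OF that])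
    show "cmod (edgeworth_char (c n) (d n) t) \<le> C2" for t
      using C2(2)[OF cd[OF n], of t] mult_left_mono[of 1 "1 + \<bar>t\<bar>\<^sup>2" "cmod (edgeworth_char (c n) (d n) t)"] by simp
    show "(edgeworth_cdf (c n) (d n) \<longlongrightarrow> 0) at_bot" by (rule edgeworth_cdf_at_bot)
    show "\<bar>edgeworth_cdf (c n) (d n) x - edgeworth_cdf (c n) (d n) y\<bar> \<le> L * \<bar>x - y\<bar>" for x y
      by (rule L(2)[OF cd[OF n]])
    fix t :: real assume "t \<noteq> 0"
    define f where "f = char M (t / sqrt n) ^ n"
    define u where "u = char (uniform_sym (\<eta> / n)) t"
    define g where "g = edgeworth_char (c n) (d n) t"
    define r where "r = \<bar>t\<bar> / (1 + t\<^sup>2)"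
    interpret U: real_distribution "uniform_sym (\<eta> / n)" by (rule real_distribution_uniform_sym[OF h])
    have u1: "cmod u \<le> 1" unfolding u_def by (rule U.cmod_char_le_1)
    have r: "0 \<le> r" by (simp add: r_def)
    have sq: "0 < 1 + t\<^sup>2" by (simp add: add_pos_nonneg)
    have "cmod (f * u - g) \<le> E n * r"
    proof (cases "\<bar>t\<bar> \<le> \<delta> * sqrt n")
      case True
      have "f * u - g = (f - g) * u + g * (u - 1)" by (simp add: algebra_simps)
      also have "cmod \<dots> \<le> cmod ((f - g) * u) + cmod (g * (u - 1))" by (rule norm_triangle_ineq)
      also have "\<dots> \<le> cmod (f - g) * 1 + C2 / (1 + t\<^sup>2) * (\<eta> / n * \<bar>t\<bar>)"
      proof (unfold norm_mult, intro add_mono mult_mono)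
        show "cmod g \<le> C2 / (1 + t\<^sup>2)"
          using C2(2)[OF cd[OF n], of t] sq by (simp add: g_def pos_le_divide_eq)
        show "cmod (u - 1) \<le> \<eta> / n * \<bar>t\<bar>"
          unfolding u_def by (rule norm_char_uniform_sym_minus_1[OF h])
      qed (use u1 C2 sq in auto)
      also have "C2 / (1 + t\<^sup>2) * (\<eta> / n * \<bar>t\<bar>) = C2 * (\<eta> / n) * r" by (simp add: r_def mult_ac)
      also have "cmod (f - g) \<le> K / (real n * sqrt n) * (A * r)"
        unfolding f_def g_def r_def using K
        by (intro order_trans[OF center[OF n True]] mult_left_mono A) auto
      finally have "cmod (f * u - g) \<le> (K * A / (real n * sqrt n) + C2 * (\<eta> / n)) * r"
        by (simp add: algebra_simps)
      also have "\<dots> \<le> E n * r"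
        unfolding E_def using r C5 \<eta> \<delta> q(1) by (intro mult_right_mono) auto
      finally show ?thesis .
    next
      case False
      then have t_gt: "\<delta> * sqrt n < \<bar>t\<bar>" by simp
      with n_large have t1: "1 \<le> \<bar>t\<bar>" by simp
      then have t2: "1 \<le> t\<^sup>2" using power_mono[of 1 "\<bar>t\<bar>" 2] by simp
      \<comment> \<open>\<open>n_large\<close> puts the whole tail into |t| >= 1, where 1 + t^2 <= 2
        t^2.\<close>
      have r_ge: "1 / \<bar>t\<bar> \<le> 2 * r"
      proof -
        have "1 + t\<^sup>2 \<le> 2 * (\<bar>t\<bar> * \<bar>t\<bar>)" using t2 by (simp add: power2_eq_square)
        then show ?thesis using t1 sq by (simp add: r_def field_simps)
      qed
      have "cmod (f * u - g) \<le> cmod f * cmod u + cmod g"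
        using norm_triangle_ineq4[of "f * u" g] by (simp add: norm_mult)
      also have "\<dots> \<le> q ^ n * (1 / (\<eta> / n * \<bar>t\<bar>)) + C5 / (\<delta> ^ 4 * real n ^ 2) * (1 / \<bar>t\<bar>)"
      proof (intro add_mono mult_mono)
        have "\<delta> \<le> \<bar>t / sqrt n\<bar>" using t_gt n by (simp add: field_simps)
        then show "cmod f \<le> q ^ n" unfolding f_def norm_power by (intro power_mono q) auto
        show "cmod u \<le> 1 / (\<eta> / n * \<bar>t\<bar>)"
          unfolding u_def by (rule norm_char_uniform_sym_le[OF h \<open>t \<noteq> 0\<close>])
        \<comment> \<open>Of the fifth power of |t|, four factors become
          \<open>\<delta> ^ 4 * real n ^ 2\<close> and the last is kept to supply 1/|t|.\<close>
        have "(\<delta> * sqrt n) ^ 4 \<le> \<bar>t\<bar> ^ 4" using t_gt \<delta> by (intro power_mono) auto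
        moreover have "sqrt n ^ 4 = (sqrt n ^ 2) ^ 2" by (subst power_mult[symmetric]) simp
        ultimately have t4: "\<delta> ^ 4 * real n ^ 2 \<le> \<bar>t\<bar> ^ 4" by (simp add: power_mult_distrib)
        have "cmod g * \<bar>t\<bar> ^ 5 \<le> cmod g * (1 + \<bar>t\<bar> ^ 5)"
          by (intro mult_left_mono) auto
        also have "\<dots> \<le> C5" unfolding g_def by (rule C5(2)[OF cd[OF n]])
        finally have "(cmod g * \<bar>t\<bar>) * \<bar>t\<bar> ^ 4 \<le> C5" by (simp add: power_numeral_reduce mult_ac)
        then have "(cmod g * \<bar>t\<bar>) * (\<delta> ^ 4 * real n ^ 2) \<le> C5"
          using mult_left_mono[OF t4, of "cmod g * \<bar>t\<bar>"] by simp
        then show "cmod g \<le> C5 / (\<delta> ^ 4 * real n ^ 2) * (1 / \<bar>t\<bar>)"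
          using \<delta> n t1 by (simp add: field_simps)
      qed (use q in auto)
      also have "\<dots> = (q ^ n / (\<eta> / n) + C5 / (\<delta> ^ 4 * real n ^ 2)) * (1 / \<bar>t\<bar>)"
        by (simp add: algebra_simps)
      also have "\<dots> \<le> (q ^ n / (\<eta> / n) + C5 / (\<delta> ^ 4 * real n ^ 2)) * (2 * r)"
        using q \<eta> C5 \<delta> by (intro mult_left_mono r_ge) auto
      also have "\<dots> = (2 * q ^ n / (\<eta> / n) + 2 * C5 / (\<delta> ^ 4 * real n ^ 2)) * r"
        by (simp add: algebra_simps)
      also have "\<dots> \<le> E n * r"
        unfolding E_def using r K A C2 \<eta> by (intro mult_right_mono) auto
      finally show ?thesis .
    qed
    then show "cmod (char (P n) t * char (uniform_sym (\<eta> / n)) t - edgeworth_char (c n) (d n) t)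
        \<le> E n * \<bar>t\<bar> / (1 + t\<^sup>2)"
      by (simp add: chP[OF n] f_def u_def g_def r_def)
  qed (use E_nonneg in auto)
  have lim_n: "(\<lambda>n. n * (E n + L * (\<eta> / n))) \<longlonglongrightarrow> (C2 + L) * \<eta>"
  proof -
    \<comment> \<open>The tail term, multiplied by n, is of size n^2 q^n. Written as the square of n
      (sqrt q)^n, it follows from the limit for a single factor n.\<close>
    have "(\<lambda>n. of_nat n * sqrt q ^ n) \<longlonglongrightarrow> 0"
      using q by (intro powser_times_n_limit_0) (simp add: real_sqrt_lt_1_iff)
    then have "(\<lambda>n. (of_nat n * sqrt q ^ n)\<^sup>2) \<longlonglongrightarrow> 0\<^sup>2" by (rule tendsto_power)
    moreover have "(of_nat n * sqrt q ^ n)\<^sup>2 = real n ^ 2 * q ^ n" for n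
    proof -
      have "(sqrt q ^ n)\<^sup>2 = (sqrt q ^ 2) ^ n" by (simp only: power_mult[symmetric] mult.commute)
      then show ?thesis using q by (simp add: power_mult_distrib)
    qed
    ultimately have qn: "(\<lambda>n. real n ^ 2 * q ^ n) \<longlonglongrightarrow> 0" by simp
    have s1: "(\<lambda>n. 1 / sqrt (real n)) \<longlonglongrightarrow> 0" by real_asymp
    have s2: "(\<lambda>n. 1 / real n) \<longlonglongrightarrow> 0" by real_asymp
    have "(\<lambda>n. K * A * (1 / sqrt n) + C2 * \<eta> + 2 / \<eta> * (real n ^ 2 * q ^ n) + 2 * C5 / \<delta> ^ 4 * (1 / n) + L * \<eta>)
       \<longlonglongrightarrow> K * A * 0 + C2 * \<eta> + 2 / \<eta> * 0 + 2 * C5 / \<delta> ^ 4 * 0 + L * \<eta>"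
      by (intro tendsto_intros s1 s2 qn)
    moreover have "\<forall>\<^sub>F n in sequentially. K * A * (1 / sqrt n) + C2 * \<eta> + 2 / \<eta> * (real n ^ 2 * q ^ n)
        + 2 * C5 / \<delta> ^ 4 * (1 / n) + L * \<eta> = n * (E n + L * (\<eta> / n))"
      using eventually_gt_at_top[of 0]
    proof eventually_elim
      case (elim n)
      have "n * (K * A / (real n * sqrt n)) = K * A * (1 / sqrt n)" "n * (C2 * (\<eta> / n)) = C2 * \<eta>"
        "n * (2 * q ^ n / (\<eta> / n)) = 2 / \<eta> * (real n ^ 2 * q ^ n)"
        "n * (2 * C5 / (\<delta> ^ 4 * real n ^ 2)) = 2 * C5 / \<delta> ^ 4 * (1 / n)" "n * (L * (\<eta> / n)) = L * \<eta>"
        using elim \<eta> \<delta> by (simp_all add: power2_eq_square)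
      then show ?case unfolding E_def by (simp only: distrib_left)
    qed
    ultimately show ?thesis
      by (rule Lim_transform_eventually[THEN tendsto_eq_rhs]) (simp add: algebra_simps)
  qed
  have "(C2 + L) * \<eta> < \<epsilon>"
  proof -
    have "(C2 + L) * \<eta> \<le> (C2 + L + 1) * \<eta>" using \<eta> by simp
    also have "\<dots> = \<epsilon> / 2"
    proof -
      have *: "Q * (\<epsilon> / (2 * Q)) = \<epsilon> / 2" if "Q > 0" for Q using that by simp
      show ?thesis unfolding \<eta>_def by (rule *) (use C2 L in simp)
    qed
    finally show ?thesis using \<open>\<epsilon> > 0\<close> by simp
  qed
  then have ev: "\<forall>\<^sub>F n in sequentially. n * (E n + L * (\<eta> / n)) < \<epsilon>"
    by (rule order_tendstoD(2)[OF lim_n])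
  have "filterlim (\<lambda>n. \<delta> * sqrt (real n)) at_top sequentially"
    using \<delta> by real_asymp
  then have "\<forall>\<^sub>F n in sequentially. 1 \<le> \<delta> * sqrt (real n)"
    by (simp add: filterlim_at_top)
  with ev eventually_gt_at_top[of 0] show ?thesis
  proof eventually_elim
    case (elim n)
    then have "E n + L * (\<eta> / n) \<le> \<epsilon> / n" by (simp add: field_simps)
    with bound[of n] elim show ?case by (blast intro: order_trans)
  qed
qed

section \<open>The inverse expansion\<close>

lemma DERIV_Phi: "(Phi has_real_derivative std_normal_density x) (at x)"
proof -
  interpret N: real_distribution std_normal_distribution by (rule real_dist_normal_dist)
  have cont: "continuous_on S std_normal_density" for S
    unfolding std_normal_density_def[abs_def] by (intro continuous_intros) auto
  define a b where "a = x - 1" and "b = x + 1"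
  have eq: "Phi y = Phi a + (LBINT t=a..y. std_normal_density t)" if "a < y" for y
  proof -
    have "Phi y - Phi a = measure std_normal_distribution {a<..y}"
      unfolding Phi_def using N.cdf_diff_eq[OF that] by simp
    also have "\<dots> = (\<integral>t. indicator {a<..y} t \<partial>std_normal_distribution)"
      by simp
    also have "\<dots> = (LBINT t=a..y. std_normal_density t)"
      using that by (subst integral_density)
        (auto simp: interval_integral_Ioc set_lebesgue_integral_def mult.commute)
    finally show ?thesis by simp
  qed
  have "((\<lambda>y. LBINT t=a..y. std_normal_density t) has_vector_derivative std_normal_density x) (at x within {a..b})"
    by (rule interval_integral_FTC2) (auto simp: a_def b_def cont)
  then have "((\<lambda>y. Phi a + (LBINT t=a..y. std_normal_density t)) has_real_derivative std_normal_density x) (at x)"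
    by (auto intro!: derivative_eq_intros
        simp: at_within_Icc_at a_def b_def has_real_derivative_iff_has_vector_derivative)
  then show ?thesis
    by (rule has_field_derivative_transform_within_open[where S="{a<..}"]) (auto simp: a_def eq[unfolded a_def])
qed

lemma abs_power_std_normal_density_bounded:
  obtains C where "0 \<le> C" "\<And>x. \<bar>x\<bar> ^ k * std_normal_density x \<le> C"
proof -
  obtain C where C: "0 \<le> C" "\<And>t::real. \<bar>t\<bar> ^ k * exp (- t\<^sup>2 / 4) \<le> C"
    by (rule abs_power_gauss_bounded[of k]) (rule that; assumption)
  show ?thesis
  proof (rule that[OF C(1)])
    fix x
    have "std_normal_density x \<le> exp (- x\<^sup>2 / 2)"
      unfolding std_normal_density_def using pi_ge_two by (intro mult_left_le_one_le) auto
    also have "\<dots> \<le> exp (- x\<^sup>2 / 4)" by simp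
    finally have "\<bar>x\<bar> ^ k * std_normal_density x \<le> \<bar>x\<bar> ^ k * exp (- x\<^sup>2 / 4)"
      by (intro mult_left_mono) auto
    with C(2)[of x] show "\<bar>x\<bar> ^ k * std_normal_density x \<le> C" by simp
  qed
qed

text \<open>The third derivative (y^2 - 1) times the normal density is bounded on the whole line, so
  the constant depends neither on \<open>x\<close> nor on the size of
  \<open>\<delta>\<close>.\<close>

lemma Phi_Taylor:
  obtains C where "0 \<le> C"
    "\<And>x \<delta>. \<bar>Phi (x + \<delta>) - (Phi x + std_normal_density x * \<delta> - x * std_normal_density x * \<delta>\<^sup>2 / 2)\<bar> \<le> C * \<bar>\<delta>\<bar> ^ 3"
proof -
  obtain C0 where C0: "0 \<le> C0" "\<And>x. \<bar>x\<bar> ^ 0 * std_normal_density x \<le> C0"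
    by (rule abs_power_std_normal_density_bounded[of 0]) (rule that; assumption)
  obtain C2 where C2: "0 \<le> C2" "\<And>x. \<bar>x\<bar> ^ 2 * std_normal_density x \<le> C2"
    by (rule abs_power_std_normal_density_bounded[of 2]) (rule that; assumption)
  define f :: "nat \<Rightarrow> real \<Rightarrow> real" where
    "f i = (if i = 0 then Phi else if i = 1 then std_normal_density
      else if i = 2 then (\<lambda>x. - x * std_normal_density x) else (\<lambda>x. (x\<^sup>2 - 1) * std_normal_density x))" for i
  show ?thesis
  proof (rule that[of "(C0 + C2) / 2"])
    fix x \<delta> :: real
    have "norm (f 0 (x + \<delta>) - (\<Sum>i\<le>2. f i x * (x + \<delta> - x) ^ i / fact i))
        \<le> (C0 + C2) * norm (x + \<delta> - x) ^ Suc 2 / fact 2"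
    proof (rule field_Taylor[of UNIV])
      fix i and y :: real assume "i \<le> (2::nat)"
      then consider "i = 0" | "i = 1" | "i = 2" by linarith
      then have "(f i has_real_derivative f (Suc i) y) (at y)"
      proof cases
        case 1
        then show ?thesis using DERIV_Phi[of y] by (simp add: f_def)
      next
        case 2
        then show ?thesis using DERIV_std_normal_density[of y] by (simp add: f_def)
      next
        case 3
        then show ?thesis unfolding f_def
          by (auto intro!: derivative_eq_intros DERIV_std_normal_density simp: algebra_simps power2_eq_square)
      qed
      then show "(f i has_field_derivative f (Suc i) y) (at y within UNIV)" by simp
    next
      fix y
      have "\<bar>(y\<^sup>2 - 1) * std_normal_density y\<bar> \<le> \<bar>y\<bar> ^ 2 * std_normal_density y + \<bar>y\<bar> ^ 0 * std_normal_density y"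
      proof -
        have "\<bar>y\<^sup>2 - 1\<bar> \<le> \<bar>y\<bar> ^ 2 + \<bar>y\<bar> ^ 0"
          unfolding power2_abs power_0 using zero_le_power2[of y] by linarith
        then show ?thesis
          unfolding abs_mult distrib_right[symmetric] by (intro mult_mono) auto
      qed
      also have "\<dots> \<le> C2 + C0" by (intro add_mono C0 C2)
      finally show "norm (f (Suc 2) y) \<le> C0 + C2" by (simp add: f_def)
    qed auto
    then show "\<bar>Phi (x + \<delta>) - (Phi x + std_normal_density x * \<delta> - x * std_normal_density x * \<delta>\<^sup>2 / 2)\<bar> \<le> (C0 + C2) / 2 * \<bar>\<delta>\<bar> ^ 3"
      by (simp add: f_def eval_nat_numeral)
  qed (use C0 C2 in auto)
qed

text \<open>\<open>p_poly\<close> with its coefficients as free parameters. The cubic 4x^3 - 7x is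
  (x (1 - x^2)^2 - He_5(x)) / 2: the second-order effect of the term c (1 - x^2) combined with the
  c^2 correction of \<open>edgeworth_cdf\<close>, in which the fifth powers cancel.\<close>

definition cornish_fisher :: "real \<Rightarrow> real \<Rightarrow> real \<Rightarrow> real" where
  "cornish_fisher c d x = x + c * (1 - x\<^sup>2) + d * (3 * x - x ^ 3) + c\<^sup>2 * (4 * x ^ 3 - 7 * x)"

text \<open>Here \<open>s\<close> stands for n^(-1/2) and \<open>k\<close> for \<kappa>_n. The shift
  has a part \<open>\<delta>1\<close> of size s k^2 and a part \<open>\<delta>2\<close> of size s^2
  k^3, which is also O(s k^2) because \<open>s * k \<le> 1\<close>. The cubic Taylor remainder then
  gives s^3 k^6, and the cross term only s^3 k^5, since |x| times the density is bounded.\<close>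

lemma Phi_cornish_fisher:
  assumes "0 \<le> B"
  obtains C where "0 \<le> C"
    "\<And>c d s k x. 0 \<le> s \<Longrightarrow> 1 \<le> k \<Longrightarrow> s * k \<le> 1 \<Longrightarrow> \<bar>c\<bar> \<le> B * s \<Longrightarrow> \<bar>d\<bar> \<le> B * s\<^sup>2 \<Longrightarrow> \<bar>x\<bar> \<le> k \<Longrightarrow>
      \<bar>Phi (cornish_fisher c d x) - edgeworth_cdf c d x\<bar> \<le> C * (s ^ 3 * k ^ 6)"
proof -
  obtain CT where CT: "0 \<le> CT"
    "\<And>x \<delta>. \<bar>Phi (x + \<delta>) - (Phi x + std_normal_density x * \<delta> - x * std_normal_density x * \<delta>\<^sup>2 / 2)\<bar> \<le> CT * \<bar>\<delta>\<bar> ^ 3"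
    by (rule Phi_Taylor) (rule that; assumption)
  obtain C1 where C1: "0 \<le> C1" "\<And>x. \<bar>x\<bar> ^ 1 * std_normal_density x \<le> C1"
    by (rule abs_power_std_normal_density_bounded[of 1]) (rule that; assumption)
  \<comment> \<open>4 = 3 + 1 and 11 = 4 + 7 are the absolute coefficient sums of the two cubics.
    \<open>H\<close> dominates both \<open>\<delta>\<close> and
    \<open>2 * \<delta>1 + \<delta>2\<close>.\<close>
  define D where "D = 4 * B + 11 * B\<^sup>2"
  define H where "H = 4 * B + D"
  have D: "0 \<le> D" and H: "0 \<le> H" using assms by (auto simp: D_def H_def)
  show ?thesis
  proof (rule that[of "CT * H ^ 3 + C1 * (D * H)"])
    show "0 \<le> CT * H ^ 3 + C1 * (D * H)" using CT C1 D H by simp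
    fix c d s k x :: real
    assume s: "0 \<le> s" and k: "1 \<le> k" and sk: "s * k \<le> 1" and c: "\<bar>c\<bar> \<le> B * s" and d: "\<bar>d\<bar> \<le> B * s\<^sup>2" and x: "\<bar>x\<bar> \<le> k"
    have k_pow: "k ^ i \<le> k ^ j" if "i \<le> j" for i j using k that by (rule power_increasing[rotated])
    have x_pow: "\<bar>x\<bar> ^ i \<le> k ^ i" for i using x by (intro power_mono) auto
    define \<delta>1 where "\<delta>1 = c * (1 - x\<^sup>2)"
    define \<delta>2 where "\<delta>2 = d * (3 * x - x ^ 3) + c\<^sup>2 * (4 * x ^ 3 - 7 * x)"
    define \<delta> where "\<delta> = \<delta>1 + \<delta>2"
    have c2: "c\<^sup>2 \<le> B\<^sup>2 * s\<^sup>2"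
      using power_mono[OF c, of 2] by (simp add: power_mult_distrib)
    have b1: "\<bar>\<delta>1\<bar> \<le> 2 * B * (s * k\<^sup>2)"
    proof -
      have "\<bar>1 - x\<^sup>2\<bar> \<le> 1 + \<bar>x\<bar> ^ 2"
        unfolding power2_abs using zero_le_power2[of x] by linarith
      also have "\<dots> \<le> 2 * k\<^sup>2" using x_pow[of 2] k_pow[of 0 2] by simp
      finally have "\<bar>\<delta>1\<bar> \<le> (B * s) * (2 * k\<^sup>2)"
        unfolding \<delta>1_def abs_mult using c assms s by (intro mult_mono) auto
      then show ?thesis by (simp add: mult_ac)
    qed
    have b2: "\<bar>\<delta>2\<bar> \<le> D * (s\<^sup>2 * k ^ 3)"
    proof -
      have x1: "\<bar>x\<bar> \<le> k ^ 3" using x_pow[of 1] k_pow[of 1 3] by simp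
      have x3: "\<bar>x ^ 3\<bar> \<le> k ^ 3" using x_pow[of 3] by (simp add: power_abs)
      have "\<bar>\<delta>2\<bar> \<le> \<bar>d\<bar> * \<bar>3 * x - x ^ 3\<bar> + c\<^sup>2 * \<bar>4 * x ^ 3 - 7 * x\<bar>"
        unfolding \<delta>2_def by (rule order_trans[OF abs_triangle_ineq]) (simp add: abs_mult)
      also have "\<dots> \<le> (B * s\<^sup>2) * (4 * k ^ 3) + (B\<^sup>2 * s\<^sup>2) * (11 * k ^ 3)"
        using d c2 assms s x1 x3 by (intro add_mono mult_mono) auto
      also have "\<dots> = D * (s\<^sup>2 * k ^ 3)" by (simp add: D_def algebra_simps)
      finally show ?thesis .
    qed
    also have "D * (s\<^sup>2 * k ^ 3) = D * (s * k\<^sup>2) * (s * k)" by (simp add: power2_eq_square power3_eq_cube)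
    also have "\<dots> \<le> D * (s * k\<^sup>2) * 1" using D s sk by (intro mult_left_mono) auto
    finally have b2': "\<bar>\<delta>2\<bar> \<le> D * (s * k\<^sup>2)" by simp
    have b: "\<bar>\<delta>\<bar> \<le> H * (s * k\<^sup>2)"
    proof -
      have "\<bar>\<delta>\<bar> \<le> 2 * B * (s * k\<^sup>2) + D * (s * k\<^sup>2)"
        unfolding \<delta>_def using b1 b2' by linarith
      also have "\<dots> \<le> H * (s * k\<^sup>2)" using assms s by (simp add: H_def algebra_simps)
      finally show ?thesis .
    qed
    have b': "\<bar>2 * \<delta>1 + \<delta>2\<bar> \<le> H * (s * k\<^sup>2)"
      using b1 b2' by (simp add: H_def algebra_simps)
    define \<phi> where "\<phi> = std_normal_density x"
    have cf: "cornish_fisher c d x = x + \<delta>"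
      by (simp add: cornish_fisher_def \<delta>_def \<delta>1_def \<delta>2_def)
    \<comment> \<open>Of \<delta>^2 only \<open>\<delta>1\<^sup>2\<close> has order s^2 and takes
      part in the exact cancellation; the rest,
      \<open>\<delta>2 * (2 * \<delta>1 + \<delta>2)\<close>, goes into the error.\<close>
    have "Phi (cornish_fisher c d x) - edgeworth_cdf c d x
        = (Phi (x + \<delta>) - (Phi x + \<phi> * \<delta> - x * \<phi> * \<delta>\<^sup>2 / 2)) - x * \<phi> * (\<delta>2 * (2 * \<delta>1 + \<delta>2)) / 2"
    proof -
      have "\<delta> - x * \<delta>1\<^sup>2 / 2 + (c * (x\<^sup>2 - 1) + d * (x ^ 3 - 3 * x) + c\<^sup>2 / 2 * (x ^ 5 - 10 * x ^ 3 + 15 * x)) = 0"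
        unfolding \<delta>_def \<delta>1_def \<delta>2_def by (simp add: field_simps eval_nat_numeral)
      then have "\<phi> * (\<delta> - x * \<delta>1\<^sup>2 / 2 + (c * (x\<^sup>2 - 1) + d * (x ^ 3 - 3 * x) + c\<^sup>2 / 2 * (x ^ 5 - 10 * x ^ 3 + 15 * x))) = 0"
        by simp
      moreover have "\<delta>\<^sup>2 = \<delta>1\<^sup>2 + \<delta>2 * (2 * \<delta>1 + \<delta>2)"
        by (simp add: \<delta>_def power2_eq_square algebra_simps)
      ultimately show ?thesis
        unfolding cf edgeworth_cdf_def \<phi>_def[symmetric] by (simp add: field_simps)
    qed
    also have "\<bar>\<dots>\<bar> \<le> CT * \<bar>\<delta>\<bar> ^ 3 + \<bar>x * \<phi> * (\<delta>2 * (2 * \<delta>1 + \<delta>2)) / 2\<bar>"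
      unfolding \<phi>_def by (intro order_trans[OF abs_triangle_ineq4] add_mono CT order_refl)
    also have "\<dots> \<le> CT * (H * (s * k\<^sup>2)) ^ 3 + C1 * (D * (s\<^sup>2 * k ^ 3) * (H * (s * k\<^sup>2)))"
    proof (rule add_mono)
      show "CT * \<bar>\<delta>\<bar> ^ 3 \<le> CT * (H * (s * k\<^sup>2)) ^ 3"
        using CT b by (intro mult_left_mono power_mono) auto
      have "\<bar>x * \<phi> * (\<delta>2 * (2 * \<delta>1 + \<delta>2)) / 2\<bar> \<le> \<bar>x * \<phi>\<bar> * (\<bar>\<delta>2\<bar> * \<bar>2 * \<delta>1 + \<delta>2\<bar>)"
        by (simp add: abs_mult)
      also have "\<dots> \<le> C1 * (D * (s\<^sup>2 * k ^ 3) * (H * (s * k\<^sup>2)))"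
      proof (intro mult_mono b2 b')
        show "\<bar>x * \<phi>\<bar> \<le> C1" using C1(2)[of x] by (simp add: \<phi>_def abs_mult)
      qed (use C1 D H s k in auto)
      finally show "\<bar>x * \<phi> * (\<delta>2 * (2 * \<delta>1 + \<delta>2)) / 2\<bar> \<le> C1 * (D * (s\<^sup>2 * k ^ 3) * (H * (s * k\<^sup>2)))" .
    qed
    also have "\<dots> = CT * H ^ 3 * (s ^ 3 * k ^ 6) + C1 * (D * H) * (s ^ 3 * k ^ 5)"
      by (simp add: eval_nat_numeral mult_ac)
    also have "\<dots> \<le> CT * H ^ 3 * (s ^ 3 * k ^ 6) + C1 * (D * H) * (s ^ 3 * k ^ 6)"
      using C1 D H s by (intro add_mono mult_left_mono order_refl k_pow) auto
    also have "\<dots> = (CT * H ^ 3 + C1 * (D * H)) * (s ^ 3 * k ^ 6)" by (simp add: algebra_simps)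
    finally show "\<bar>Phi (cornish_fisher c d x) - edgeworth_cdf c d x\<bar> \<le> (CT * H ^ 3 + C1 * (D * H)) * (s ^ 3 * k ^ 6)" .
  qed
qed

text \<open>The assumption \<open>small\<close> bounds the deviation of the derivative from 1 on the
  interval, term by term.\<close>

lemma strict_mono_on_cornish_fisher:
  assumes k: "0 \<le> k" and small: "2 * \<bar>c\<bar> * k + \<bar>d\<bar> * (3 + 3 * k\<^sup>2) + c\<^sup>2 * (12 * k\<^sup>2 + 7) < 1"
  shows "strict_mono_on {-k..k} (cornish_fisher c d)"
proof (rule strict_mono_onI)
  fix x y assume xy: "x \<in> {-k..k}" "y \<in> {-k..k}" "x < y"
  show "cornish_fisher c d x < cornish_fisher c d y"
  proof (rule DERIV_pos_imp_increasing[OF \<open>x < y\<close>])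
    fix z assume "x \<le> z" "z \<le> y"
    then have z: "\<bar>z\<bar> \<le> k" using xy by auto
    have z2: "z\<^sup>2 \<le> k\<^sup>2" using power_mono[OF z, of 2] by simp
    let ?D = "1 - 2 * c * z + d * (3 - 3 * z\<^sup>2) + c\<^sup>2 * (12 * z\<^sup>2 - 7)"
    have "(cornish_fisher c d has_real_derivative ?D) (at z)"
      unfolding cornish_fisher_def[abs_def]
      by (auto intro!: derivative_eq_intros simp: algebra_simps power2_eq_square)
    moreover have "\<bar>2 * c * z\<bar> \<le> 2 * \<bar>c\<bar> * k" using z by (simp add: abs_mult mult_left_mono)
    moreover have "\<bar>d * (3 - 3 * z\<^sup>2)\<bar> \<le> \<bar>d\<bar> * (3 + 3 * k\<^sup>2)"
    proof -
      have "\<bar>3 - 3 * z\<^sup>2\<bar> \<le> 3 + 3 * k\<^sup>2" using z2 zero_le_power2[of z] by linarith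
      then show ?thesis unfolding abs_mult by (rule mult_left_mono) simp
    qed
    moreover have "\<bar>c\<^sup>2 * (12 * z\<^sup>2 - 7)\<bar> \<le> c\<^sup>2 * (12 * k\<^sup>2 + 7)"
    proof -
      have "\<bar>12 * z\<^sup>2 - 7\<bar> \<le> 12 * k\<^sup>2 + 7" using z2 zero_le_power2[of z] by linarith
      then show ?thesis unfolding abs_mult by (auto intro: mult_left_mono)
    qed
    ultimately show "\<exists>D. (cornish_fisher c d has_real_derivative D) (at z) \<and> D > 0"
      using small by (intro exI[of _ ?D]) linarith
  qed
qed

section \<open>Assembly for the normalized sums\<close>

theorem theorem2:
  fixes M :: "'a measure" and F :: "real measure"
    and X :: "nat \<Rightarrow> 'a \<Rightarrow> real" and \<kappa> :: "nat \<Rightarrow> real"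
  assumes "prob_space M"
    and "real_distribution F"
    and "prob_space.indep_vars M (\<lambda>i. borel) X UNIV"
    and "\<And>i. distr M borel (X i) = F"
    and "\<And>k::nat. integrable F (\<lambda>x. x ^ k)"
    and "(\<integral>x. x \<partial>F) = 0"
    and "(\<integral>x. x\<^sup>2 \<partial>F) > 0"
    and "(char F \<longlongrightarrow> 0) at_top" and "(char F \<longlongrightarrow> 0) at_bot"
    and "\<And>n. 1 \<le> \<kappa> n"
    and "\<kappa> \<in> o(\<lambda>n. real n powr (1/16))"
  shows "let \<mu> = (\<lambda>k::nat. \<integral>x. x ^ k \<partial>F);
             \<sigma> = sqrt (\<mu> 2);
             S = (\<lambda>n \<omega>. (\<Sum>i<n. X i \<omega>) / (\<sigma> * sqrt (real n)));
             Fn = (\<lambda>n x. measure M {\<omega> \<in> space M. S n \<omega> \<le> x});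
             p = p_poly (\<mu> 2) (\<mu> 3) (\<mu> 4)
         in (\<forall>\<^sub>F n in sequentially. strict_mono_on {-\<kappa> n..\<kappa> n} (p n))
            \<and> (\<lambda>n. SUP x\<in>{-\<kappa> n..\<kappa> n}. \<bar>Phi (p n x) - Fn n x\<bar>) \<in> o(\<lambda>n. 1 / real n)"
proof -
  interpret M: prob_space M by fact
  interpret F: real_distribution F by fact
  define \<mu> where "\<mu> k = (\<integral>x. x ^ k \<partial>F)" for k :: nat
  define \<sigma> where "\<sigma> = sqrt (\<mu> 2)"
  define S where "S n \<omega> = (\<Sum>i<n. X i \<omega>) / (\<sigma> * sqrt (real n))" for n \<omega>
  define Fn where "Fn n x = measure M {\<omega> \<in> space M. S n \<omega> \<le> x}" for n x
  define p where "p = p_poly (\<mu> 2) (\<mu> 3) (\<mu> 4)"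
  define c where "c = c_coef (\<mu> 2) (\<mu> 3)"
  define d where "d = d_coef (\<mu> 2) (\<mu> 4)"
  have \<mu>2: "0 < \<mu> 2" using assms(7) by (simp add: \<mu>_def)
  have \<sigma>: "0 < \<sigma>" "\<sigma>\<^sup>2 = \<mu> 2" using \<mu>2 by (auto simp: \<sigma>_def)
  have \<sigma>3: "\<sigma> ^ 3 = \<mu> 2 powr (3/2)"
  proof -
    have "\<sigma> = \<mu> 2 powr (1/2)" using \<mu>2 by (simp add: \<sigma>_def powr_half_sqrt)
    then show ?thesis using \<mu>2 by (simp add: powr_powr flip: powr_realpow)
  qed
  have p_eq: "p n = cornish_fisher (c n) (d n)" for n
    by (rule ext) (simp add: p_def p_poly_def cornish_fisher_def c_def d_def)
  have [measurable]: "X i \<in> borel_measurable M" for i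
    using assms(3) unfolding M.indep_vars_def2 by simp

  \<comment> \<open>The law of a single summand scaled to variance 1. Its moments \<mu>_k/\<sigma>^k
    turn the coefficients of the standardized expansion into \<open>c_coef\<close> and
    \<open>d_coef\<close>.\<close>
  define N where "N = distr F borel (\<lambda>x. x / \<sigma>)"
  interpret N: real_distribution N
    unfolding N_def by (rule F.real_distribution_distr) simp
  have N_int: "integrable N (\<lambda>x. x ^ k)" for k
    unfolding N_def using assms(5)[of k] by (subst integrable_distr_eq) (auto simp: power_divide)
  have N_mom: "N.expectation (\<lambda>x. x ^ k) = \<mu> k / \<sigma> ^ k" for k
    unfolding N_def \<mu>_def by (subst integral_distr) (auto simp: power_divide)
  have charN: "char N u = char F (u / \<sigma>)" for u
    unfolding char_def N_def by (subst integral_distr) auto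
  have limF: "(char F \<longlongrightarrow> 0) at_infinity"
    unfolding at_infinity_eq_at_top_bot using assms(8,9) by (simp add: filterlim_sup)
  have "filterlim (\<lambda>u. u / \<sigma>) at_infinity at_infinity"
  proof -
    have "filterlim (\<lambda>u. inverse \<sigma> * u) at_infinity at_infinity"
      using \<sigma> by (intro tendsto_mult_filterlim_at_infinity[OF tendsto_const] filterlim_ident) auto
    then show ?thesis by (simp add: field_simps)
  qed
  then have limN: "(char N \<longlongrightarrow> 0) at_infinity"
    unfolding charN[abs_def] by (rule filterlim_compose[OF limF])

  define P where "P n = distr M borel (S n)" for n
  have S_meas [measurable]: "S n \<in> borel_measurable M" for n
    unfolding S_def by measurable
  have P: "real_distribution (P n)" for n
    unfolding P_def by (rule M.real_distribution_distr) measurable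
  have cdfP: "cdf (P n) x = Fn n x" for n x
    unfolding cdf_def P_def Fn_def
    by (subst measure_distr) (auto intro!: arg_cong2[where f=measure])
  have charP: "char (P n) t = char N (t / sqrt n) ^ n" if "0 < n" for n t
  proof -
    define Y where "Y i \<omega> = X i \<omega> / (\<sigma> * sqrt n)" for i \<omega>
    have charY: "char (distr M borel (Y i)) t = char N (t / sqrt n)" for i
    proof -
      have "char F (t / sqrt n / \<sigma>) = (CLINT \<omega>|M. iexp (t / sqrt n / \<sigma> * X i \<omega>))"
        unfolding char_def assms(4)[of i, symmetric] by (subst integral_distr) auto
      then show ?thesis
        unfolding charN char_def[of "distr M borel (Y i)"] Y_def
        by (subst integral_distr) (auto simp: mult_ac)
    qed
    have "M.indep_vars (\<lambda>i. borel) Y {..<n}"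
      unfolding Y_def
      by (rule M.indep_vars_compose2[where X=X, OF M.indep_vars_subset[OF assms(3)]]) auto
    then have "char (distr M borel (\<lambda>\<omega>. \<Sum>i<n. Y i \<omega>)) t = (\<Prod>i<n. char (distr M borel (Y i)) t)"
      by (rule M.char_distr_sum)
    also have "(\<lambda>\<omega>. \<Sum>i<n. Y i \<omega>) = S n"
      by (simp add: S_def[abs_def] Y_def sum_divide_distrib)
    finally show ?thesis by (simp add: P_def charY)
  qed

  have c_eq: "N.expectation (\<lambda>x. x ^ 3) / (6 * sqrt (real n)) = c n" for n
    unfolding N_mom c_def c_coef_def \<sigma>3 by simp
  have d_eq: "(N.expectation (\<lambda>x. x ^ 4) - 3) / (24 * real n) = d n" for n
  proof -
    have "\<sigma> ^ 4 = (\<mu> 2)\<^sup>2" using \<sigma>(2) by (simp flip: \<sigma>(2) power_mult)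
    then show ?thesis unfolding N_mom d_def d_coef_def using \<mu>2 by (simp add: field_simps)
  qed
  have edgeworth: "\<forall>\<^sub>F n in sequentially. \<forall>x. \<bar>Fn n x - edgeworth_cdf (c n) (d n) x\<bar> \<le> \<epsilon> / n" if "\<epsilon> > 0" for \<epsilon>
    using N.edgeworth_expansion[where P=P and \<epsilon>=\<epsilon>, OF N_int _ _ limN P charP that] N_mom[of 1] N_mom[of 2] \<sigma> \<mu>2 assms(6)
    unfolding c_eq d_eq cdfP by (simp add: \<mu>_def)

  define B where "B = max \<bar>N.expectation (\<lambda>x. x ^ 3)\<bar> \<bar>N.expectation (\<lambda>x. x ^ 4) - 3\<bar>"
  \<comment> \<open>Since division by zero gives 0, the estimates for \<open>c\<close> and
    \<open>d\<close> in terms of \<open>s\<close> hold at \<open>n = 0\<close> too.\<close>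
  define s where "s n = 1 / sqrt (real n)" for n
  have s: "0 \<le> s n" "(s n)\<^sup>2 = 1 / n" for n by (auto simp: s_def power_divide)
  have B_ge: "\<bar>N.expectation (\<lambda>x. x ^ 3)\<bar> \<le> B" "\<bar>N.expectation (\<lambda>x. x ^ 4) - 3\<bar> \<le> B"
    by (simp_all add: B_def)
  then have B: "0 \<le> B" by linarith
  have c_le: "\<bar>c n\<bar> \<le> B * s n" for n
  proof -
    have "\<bar>c n\<bar> = (\<bar>N.expectation (\<lambda>x. x ^ 3)\<bar> / 6) * s n"
      unfolding c_eq[symmetric] by (simp add: s_def abs_mult abs_divide)
    also have "\<dots> \<le> B * s n" using s B_ge B by (intro mult_right_mono) auto
    finally show ?thesis .
  qed
  have d_le: "\<bar>d n\<bar> \<le> B * (s n)\<^sup>2" for n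
  proof -
    have "\<bar>d n\<bar> = (\<bar>N.expectation (\<lambda>x. x ^ 4) - 3\<bar> / 24) * (s n)\<^sup>2"
      unfolding d_eq[symmetric] s(2) by (simp add: abs_mult abs_divide)
    also have "\<dots> \<le> B * (s n)\<^sup>2" using B_ge B by (intro mult_right_mono) auto
    finally show ?thesis .
  qed
  obtain C where C: "0 \<le> C"
    "\<And>c d s k x. 0 \<le> s \<Longrightarrow> 1 \<le> k \<Longrightarrow> s * k \<le> 1 \<Longrightarrow> \<bar>c\<bar> \<le> B * s \<Longrightarrow> \<bar>d\<bar> \<le> B * s\<^sup>2 \<Longrightarrow> \<bar>x\<bar> \<le> k \<Longrightarrow>
      \<bar>Phi (cornish_fisher c d x) - edgeworth_cdf c d x\<bar> \<le> C * (s ^ 3 * k ^ 6)"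
    by (rule Phi_cornish_fisher[OF B]) (rule that; assumption)

  have \<kappa>_le: "\<forall>\<^sub>F n in sequentially. \<kappa> n \<le> real n powr (1/16)"
    using landau_o.smallD[OF assms(11), of 1] assms(10)
    by (auto elim!: eventually_mono)
  \<comment> \<open>Where the growth condition enters: the exponent is 6/16 - 1/2 = -1/8. Multiplied
    by 1/n this becomes the bound s^3 \<kappa>^6 = o(1/n).\<close>
  have pow6: "(\<lambda>n. s n * \<kappa> n ^ 6) \<longlonglongrightarrow> 0"
  proof (rule tendsto_sandwich)
    show "\<forall>\<^sub>F n in sequentially. 0 \<le> s n * \<kappa> n ^ 6"
      using s order_trans[OF zero_le_one assms(10)] by (intro always_eventually) simp
    show "\<forall>\<^sub>F n in sequentially. s n * \<kappa> n ^ 6 \<le> s n * (real n powr (1/16)) ^ 6"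
      using \<kappa>_le
    proof eventually_elim
      case (elim n)
      then show ?case using s order_trans[OF zero_le_one assms(10)[of n]]
        by (intro mult_left_mono power_mono) auto
    qed
    show "(\<lambda>n. s n * (real n powr (1/16)) ^ 6) \<longlonglongrightarrow> 0"
      unfolding s_def by real_asymp
  qed simp
  have sk: "(\<lambda>n. s n * \<kappa> n) \<longlonglongrightarrow> 0"
  proof (rule tendsto_sandwich[OF _ _ tendsto_const pow6])
    show "\<forall>\<^sub>F n in sequentially. 0 \<le> s n * \<kappa> n"
      using s order_trans[OF zero_le_one assms(10)] by (intro always_eventually) simp
    show "\<forall>\<^sub>F n in sequentially. s n * \<kappa> n \<le> s n * \<kappa> n ^ 6"
      using s power_increasing[of 1 6 "\<kappa> n" for n] assms(10)
      by (intro always_eventually allI mult_left_mono) auto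
  qed

  have mono: "\<forall>\<^sub>F n in sequentially. strict_mono_on {-\<kappa> n..\<kappa> n} (p n)"
  proof -
    \<comment> \<open>Because \<kappa> >= 1, the constants in \<open>small\<close> merge into the
      quadratic terms: 3 + 3 = 6 and 12 + 7 = 19.\<close>
    have "(\<lambda>n. 2 * B * (s n * \<kappa> n) + 6 * B * (s n * \<kappa> n)\<^sup>2 + 19 * B\<^sup>2 * (s n * \<kappa> n)\<^sup>2)
       \<longlonglongrightarrow> 2 * B * 0 + 6 * B * 0\<^sup>2 + 19 * B\<^sup>2 * 0\<^sup>2"
      by (intro tendsto_intros sk)
    then have "\<forall>\<^sub>F n in sequentially. 2 * B * (s n * \<kappa> n) + 6 * B * (s n * \<kappa> n)\<^sup>2 + 19 * B\<^sup>2 * (s n * \<kappa> n)\<^sup>2 < 1"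
      by (rule order_tendstoD) simp
    then show ?thesis
    proof eventually_elim
      case (elim n)
      have k: "1 \<le> \<kappa> n" by (rule assms(10))
      then have k2: "1 \<le> (\<kappa> n)\<^sup>2" by simp
      have c2: "(c n)\<^sup>2 \<le> B\<^sup>2 * (s n)\<^sup>2"
        using power_mono[OF c_le[of n], of 2] by (simp add: power_mult_distrib)
      have "2 * \<bar>c n\<bar> * \<kappa> n + \<bar>d n\<bar> * (3 + 3 * (\<kappa> n)\<^sup>2) + (c n)\<^sup>2 * (12 * (\<kappa> n)\<^sup>2 + 7)
          \<le> 2 * (B * s n) * \<kappa> n + (B * (s n)\<^sup>2) * (6 * (\<kappa> n)\<^sup>2) + (B\<^sup>2 * (s n)\<^sup>2) * (19 * (\<kappa> n)\<^sup>2)"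
        using c_le[of n] d_le[of n] c2 k k2 B s by (intro add_mono mult_mono) auto
      also have "\<dots> < 1" using elim by (simp add: power_mult_distrib mult_ac)
      finally show ?case unfolding p_eq using k by (intro strict_mono_on_cornish_fisher) auto
    qed
  qed

  have "(\<lambda>n. SUP x\<in>{-\<kappa> n..\<kappa> n}. \<bar>Phi (p n x) - Fn n x\<bar>) \<in> o(\<lambda>n. 1 / real n)"
  proof (rule landau_o.smallI)
    fix \<epsilon> :: real assume \<epsilon>: "\<epsilon> > 0"
    have "(\<lambda>n. C * (s n * \<kappa> n ^ 6)) \<longlonglongrightarrow> C * 0" by (intro tendsto_intros pow6)
    then have "\<forall>\<^sub>F n in sequentially. C * (s n * \<kappa> n ^ 6) < \<epsilon> / 2"
      by (rule order_tendstoD) (use \<epsilon> in simp)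
    moreover have "\<forall>\<^sub>F n in sequentially. s n * \<kappa> n < 1" by (rule order_tendstoD[OF sk]) simp
    moreover have "\<forall>\<^sub>F n in sequentially. \<forall>x. \<bar>Fn n x - edgeworth_cdf (c n) (d n) x\<bar> \<le> \<epsilon> / 2 / n"
      by (rule edgeworth) (use \<epsilon> in simp)
    ultimately show "\<forall>\<^sub>F n in sequentially. norm (SUP x\<in>{-\<kappa> n..\<kappa> n}. \<bar>Phi (p n x) - Fn n x\<bar>) \<le> \<epsilon> * norm (1 / real n)"
    proof eventually_elim
      case (elim n)
      have k: "1 \<le> \<kappa> n" by (rule assms(10))
      have bd: "\<bar>Phi (p n x) - Fn n x\<bar> \<le> \<epsilon> * (1 / n)" if "x \<in> {-\<kappa> n..\<kappa> n}" for x
      proof -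
        have "\<bar>Phi (p n x) - edgeworth_cdf (c n) (d n) x\<bar> \<le> C * (s n ^ 3 * \<kappa> n ^ 6)"
          unfolding p_eq using that elim(2) by (intro C s(1) k c_le d_le) auto
        also have "s n ^ 3 = s n * (1 / n)" by (simp add: power3_eq_cube flip: s(2)) (simp add: power2_eq_square)
        also have "C * (s n * (1 / n) * \<kappa> n ^ 6) = C * (s n * \<kappa> n ^ 6) * (1 / n)" by (simp add: mult_ac)
        also have "\<dots> \<le> \<epsilon> / 2 * (1 / n)" using elim(1) by (intro mult_right_mono) auto
        finally have "\<bar>Phi (p n x) - edgeworth_cdf (c n) (d n) x\<bar> \<le> \<epsilon> / 2 * (1 / n)" .
        moreover have "\<bar>Fn n x - edgeworth_cdf (c n) (d n) x\<bar> \<le> \<epsilon> / 2 * (1 / n)" using elim(3) by simp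
        ultimately show ?thesis by linarith
      qed
      \<comment> \<open>A real \<open>SUP\<close> is meaningful only over a nonempty bounded set; 0
        is a witness because \<kappa> >= 1, and \<open>bd\<close> gives the bound.\<close>
      have ne: "0 \<in> {-\<kappa> n..\<kappa> n}" using k by simp
      have "(SUP x\<in>{-\<kappa> n..\<kappa> n}. \<bar>Phi (p n x) - Fn n x\<bar>) \<le> \<epsilon> * (1 / n)"
        using ne by (intro cSUP_least bd) auto
      moreover have "0 \<le> (SUP x\<in>{-\<kappa> n..\<kappa> n}. \<bar>Phi (p n x) - Fn n x\<bar>)"
        by (rule order_trans[OF abs_ge_zero cSUP_upper[OF ne]]) (rule bdd_aboveI2[OF bd])
      ultimately show ?case by simp
    qed
  qed
  with mono show ?thesis
    unfolding Let_def \<mu>_def \<sigma>_def S_def Fn_def p_def by (auto cong: SUP_cong)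
qed

end
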